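(* Let $d\ge 3$, let $Q$ be a nondegenerate indefinite quadratic form on $\mathbb{R}^{d+1}$ with rational coefficients, $m\in\mathbb{Q}\setminus\{0\}$, $X=\{w\in\mathbb{R}^{d+1}:Q(w)=m\}$, and assume $X\cap\mathbb{Z}^{d+1}\ne\emptyset$. Let $\psi:(0,\infty)\to(0,\infty)$ be a measurable quasi-conformal function. Then for any $v\in\partial X$, \[\mathrm{vol}(C(v,\psi))=\infty\iff \int_1^\infty t^{d-2}\psi(t)^{d-1}\,dt=\int_0^\infty (e^t\psi(e^t))^{d-1}\,dt=\infty.\]
   Context: $\|\cdot\|$ is the Euclidean norm and $\pi(x)=x/\|x\|$. $\psi$ quasi-conformal: there is $c>0$ with $\psi(ht)\le c\psi(t)$ for $h\in[1/2,2]$, $t>0$. $\mathrm{vol}$ is a $\mathrm{O}(Q)$-invariant measure on $X$. $\partial X=\{x:Q(x)=0\}\cap S^d$. For $v\in\partial X$, $C(v,\psi)=\{x\in X:\|\pi(x)-v\|<\psi(\|x\|)\}$. *)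

theory Defs
  imports "HOL-Analysis.Analysis"
begin

text \<open>
  Quadratic forms on \<open>\<real>\<^sup>n\<close> are functions on \<open>real ^ 'n\<close>. The coefficients below need not be
  symmetric: the coefficient of the monomial \<open>x\<^sub>i x\<^sub>j\<close> with \<open>i \<noteq> j\<close> is \<open>a i j + a j i\<close>.
\<close>

definition rational_quadratic_form :: "(real ^ 'n \<Rightarrow> real) \<Rightarrow> bool" where
  "rational_quadratic_form Q \<longleftrightarrow>
     (\<exists>a :: 'n \<Rightarrow> 'n \<Rightarrow> real.
        (\<forall>i j. a i j \<in> \<rat>) \<and>
        (\<forall>x. Q x = (\<Sum>i\<in>UNIV. \<Sum>j\<in>UNIV. a i j * x $ i * x $ j)))"

definition polar_form :: "('a::plus \<Rightarrow> real) \<Rightarrow> 'a \<Rightarrow> 'a \<Rightarrow> real" where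
  "polar_form Q x y = Q (x + y) - Q x - Q y"

definition nondegenerate_form :: "('a::monoid_add \<Rightarrow> real) \<Rightarrow> bool" where
  "nondegenerate_form Q \<longleftrightarrow> (\<forall>x. (\<forall>y. polar_form Q x y = 0) \<longrightarrow> x = 0)"

definition indefinite_form :: "('a \<Rightarrow> real) \<Rightarrow> bool" where
  "indefinite_form Q \<longleftrightarrow> (\<exists>x. Q x > 0) \<and> (\<exists>x. Q x < 0)"

definition orthogonal_group :: "('a::real_vector \<Rightarrow> real) \<Rightarrow> ('a \<Rightarrow> 'a) set" where
  "orthogonal_group Q = {g. linear g \<and> bij g \<and> (\<forall>x. Q (g x) = Q x)}"

definition quadric :: "('a \<Rightarrow> real) \<Rightarrow> real \<Rightarrow> 'a set" where
  "quadric Q m = {w. Q w = m}"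

definition quadric_boundary :: "('a::real_normed_vector \<Rightarrow> real) \<Rightarrow> 'a set" where
  "quadric_boundary Q = {x. Q x = 0} \<inter> sphere 0 1"

definition integer_lattice :: "(real ^ 'n) set" where
  "integer_lattice = {x. \<forall>i. x $ i \<in> \<int>}"

text \<open>
  An \<open>O(Q)\<close>-invariant measure on the quadric is understood to be a nonzero Radon measure, as usual
  for invariant measures on homogeneous spaces. The quadric is closed in \<open>\<real>\<^sup>n\<close>, so finiteness on
  compact sets is all that has to be required of a Borel measure. Without it the counting measure
  would also be allowed.
\<close>

definition invariant_measure_on_quadric ::
    "('a::euclidean_space \<Rightarrow> real) \<Rightarrow> real \<Rightarrow> 'a measure \<Rightarrow> bool" where
  "invariant_measure_on_quadric Q m vol \<longleftrightarrow>
     sets vol = sets (restrict_space borel (quadric Q m)) \<and>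
     (\<forall>K. compact K \<and> K \<subseteq> quadric Q m \<longrightarrow> emeasure vol K < \<infinity>) \<and>
     emeasure vol (quadric Q m) \<noteq> 0 \<and>
     (\<forall>g\<in>orthogonal_group Q. \<forall>A\<in>sets vol. emeasure vol (g ` A) = emeasure vol A)"

text \<open>Functions on \<open>(0, \<infinity>)\<close> are represented by functions on \<^typ>\<open>real\<close> whose values on
  \<open>(-\<infinity>, 0]\<close> are irrelevant.\<close>

definition quasi_conformal :: "(real \<Rightarrow> real) \<Rightarrow> bool" where
  "quasi_conformal \<psi> \<longleftrightarrow>
     (\<exists>c>0. \<forall>t>0. \<forall>h\<in>{1/2..2}. \<psi> (h * t) \<le> c * \<psi> t)"

definition radial_projection :: "'a::real_normed_vector \<Rightarrow> 'a" where
  "radial_projection x = x /\<^sub>R norm x"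

definition approximation_cone ::
    "('a::real_normed_vector \<Rightarrow> real) \<Rightarrow> real \<Rightarrow> 'a \<Rightarrow> (real \<Rightarrow> real) \<Rightarrow> 'a set" where
  "approximation_cone Q m v \<psi> =
     {x \<in> quadric Q m. norm (radial_projection x - v) < \<psi> (norm x)}"

end

theory Submission
  imports Defs
begin

text \<open>
  Complete \<open>v\<close> to a hyperbolic pair \<open>v, w\<close> and write \<open>p = x v + y w + z\<close> with \<open>z\<close> orthogonal to both, so that
  \<open>Q p = x y + Q z\<close>. On the part \<open>x > 0\<close> of the quadric, \<open>(x, z / x)\<close> are coordinates. The unipotent maps fixing
  \<open>w\<close> translate \<open>z / x\<close> at constant \<open>x\<close>, and the hyperbolic rotations \<open>x \<mapsto> l x\<close>, \<open>y \<mapsto> y / l\<close> scale \<open>z / x\<close>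
  by \<open>1 / l\<close>. Invariance under these two families alone forces the box \<open>l \<le> x < 2 l\<close>, \<open>\<bar>z / x\<bar> \<le> r\<close> to have
  measure comparable to \<open>(l r)\<^bsup>d-1\<^esup>\<close>, without any uniqueness theorem for invariant measures.

  Over \<open>x \<approx> 2\<^sup>k\<close> the cone is a box with \<open>r \<approx> \<psi>(2\<^sup>k)\<close>, except for those \<open>k\<close> where \<open>\<psi>(2\<^sup>k)\<close> drops below the order
  \<open>4\<^bsup>-k\<^esup>\<close> of the distance from the radially projected quadric to the light cone; these contribute a convergent series. So the volume and
  the integral are both infinite exactly when \<open>\<Sum>\<^sub>k (2\<^sup>k \<psi>(2\<^sup>k))\<^bsup>d-1\<^esup>\<close> diverges.
\<close>

section \<open>Hyperbolic coordinates\<close>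

lemma polar_form_commute: "polar_form Q x y = polar_form Q y (x :: 'a::ab_semigroup_add)"
  by (simp add: polar_form_def add.commute)

text \<open>Expanding \<open>Q (x + y)\<close> symmetrises the coefficients, and on the diagonal the
  polar form counts every monomial twice. The later algebra with \<open>Q\<close> runs through these
  two facts.\<close>

lemma
  assumes "rational_quadratic_form Q"
  shows rational_quadratic_form_bilinear_polar: "bilinear (polar_form Q)"
    and rational_quadratic_form_eq_half_polar: "Q x = polar_form Q x x / 2"
proof -
  obtain a where a: "Q x = (\<Sum>i\<in>UNIV. \<Sum>j\<in>UNIV. a i j * x $ i * x $ j)" for x
    using assms by (auto simp: rational_quadratic_form_def)
  have P: "polar_form Q x y = (\<Sum>i\<in>UNIV. \<Sum>j\<in>UNIV. a i j * (x $ i * y $ j + y $ i * x $ j))" for x y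
    by (simp add: polar_form_def a sum.distrib algebra_simps)
  show "bilinear (polar_form Q)"
    unfolding bilinear_def P
    by (auto intro!: linearI simp: sum.distrib algebra_simps sum_distrib_left)
  show "Q x = polar_form Q x x / 2"
    by (simp add: P a sum_divide_distrib mult.assoc)
qed

text \<open>\<open>E\<close> is orthonormal for the Euclidean inner product, not for
  \<open>Q\<close>, which may be indefinite on \<open>span E\<close>. Its Euclidean coordinates
  serve to cut out cubes in the \<open>Q\<close>-orthogonal complement of the pair \<open>v\<close>,
  \<open>w\<close>.\<close>

locale isotropic_frame =
  fixes Q :: "'a::euclidean_space \<Rightarrow> real" and v w :: 'a and E :: "'a set"
  assumes bilinear_polar: "bilinear (polar_form Q)"
    and eq_half_polar: "\<And>x. Q x = polar_form Q x x / 2"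
    and isotropic: "Q v = 0" "Q w = 0" and dual: "polar_form Q v w = 1"
    and finite_E: "finite E" and orthogonal_E: "pairwise orthogonal E"
    and norm_E: "\<And>b. b \<in> E \<Longrightarrow> norm b = 1"
    and span_E: "span E = {z. polar_form Q z v = 0 \<and> polar_form Q z w = 0}"
begin

abbreviation "B \<equiv> polar_form Q"

text \<open>As \<open>v\<close> and \<open>w\<close> are isotropic with \<open>B v w = 1\<close>,
  pairing with one of them reads off the coefficient of the other. \<open>cv\<close>,
  \<open>cw\<close>, \<open>cz\<close> give the coordinates \<open>x\<close>, \<open>y\<close>,
  \<open>z\<close> of the introduction.\<close>

definition "cv p = B p w"
definition "cw p = B p v"
definition "cz p = p - cv p *\<^sub>R v - cw p *\<^sub>R w"

lemmas B_simps = bilinear_ladd[OF bilinear_polar] bilinear_radd[OF bilinear_polar]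
  bilinear_lsub[OF bilinear_polar] bilinear_rsub[OF bilinear_polar]
  bilinear_lmul[OF bilinear_polar] bilinear_rmul[OF bilinear_polar]
  bilinear_lneg[OF bilinear_polar] bilinear_rneg[OF bilinear_polar]
  bilinear_lzero[OF bilinear_polar] bilinear_rzero[OF bilinear_polar]

lemma B_frame [simp]: "B v v = 0" "B w w = 0" "B v w = 1" "B w v = 1"
  using isotropic dual eq_half_polar[of v] eq_half_polar[of w]
  by (auto simp: polar_form_commute[of Q w v])

lemma linear_coords: "linear cv" "linear cw" "linear cz"
proof -
  show *: "linear cv" "linear cw"
    by (auto simp: cv_def[abs_def] cw_def[abs_def] B_simps intro!: linearI)
  show "linear cz"
    by (auto simp: cz_def[abs_def] linear_add[OF *(1)] linear_add[OF *(2)]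
       linear_scale[OF *(1)] linear_scale[OF *(2)] algebra_simps intro!: linearI)
qed

lemma coords: "p = cv p *\<^sub>R v + cw p *\<^sub>R w + cz p"
  by (simp add: cz_def)

lemma B_cz [simp]: "B (cz p) v = 0" "B (cz p) w = 0" "B v (cz p) = 0" "B w (cz p) = 0"
  by (simp_all add: cz_def cv_def cw_def B_simps polar_form_commute[of Q v p] polar_form_commute[of Q w p])

lemma cz_in_span: "cz p \<in> span E"
  by (simp add: span_E)

lemma span_E_D:
  assumes "z \<in> span E"
  shows "B z v = 0" "B z w = 0" "B v z = 0" "B w z = 0"
  using assms by (auto simp: span_E polar_form_commute[of Q v] polar_form_commute[of Q w])

lemma coords_eq:
  assumes "z \<in> span E"
  shows "cv (a *\<^sub>R v + b *\<^sub>R w + z) = a" "cw (a *\<^sub>R v + b *\<^sub>R w + z) = b"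
    "cz (a *\<^sub>R v + b *\<^sub>R w + z) = z"
  using span_E_D[OF assms] by (simp_all add: cz_def cv_def cw_def B_simps)

lemma Q_frame:
  assumes "z \<in> span E"
  shows "Q (a *\<^sub>R v + b *\<^sub>R w + z) = a * b + Q z"
  using span_E_D[OF assms]
  by (simp add: eq_half_polar B_simps algebra_simps)

lemma Q_coords: "Q p = cv p * cw p + Q (cz p)"
  by (subst (1) coords) (simp add: Q_frame cz_in_span)

lemma Q_uminus: "Q (- p) = Q p"
  by (simp add: eq_half_polar B_simps)

section \<open>Boosts, shears and the swap as elements of the orthogonal group\<close>

definition boost :: "real \<Rightarrow> 'a \<Rightarrow> 'a" where
  "boost l p = (l * cv p) *\<^sub>R v + (cw p / l) *\<^sub>R w + cz p"

text \<open>This is the Eichler transvection fixing \<open>w\<close>. It moves \<open>z / x\<close>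
  by \<open>s\<close>, and the new coefficient of \<open>w\<close> is the one that keeps
  \<open>x y + Q z\<close> unchanged.\<close>

definition shear :: "'a \<Rightarrow> 'a \<Rightarrow> 'a" where
  "shear s p = cv p *\<^sub>R v + (cw p - cv p * Q s - B (cz p) s) *\<^sub>R w + (cz p + cv p *\<^sub>R s)"

text \<open>Exchanging the two isotropic vectors preserves \<open>x y\<close>; it will carry a
  statement about \<open>w\<close> over to \<open>v\<close>.\<close>

definition swap :: "'a \<Rightarrow> 'a" where
  "swap p = cw p *\<^sub>R v + cv p *\<^sub>R w + cz p"

lemma coords_boost [simp]: "cv (boost l p) = l * cv p" "cw (boost l p) = cw p / l" "cz (boost l p) = cz p"
  by (simp_all add: boost_def coords_eq cz_in_span)

lemma coords_shear:
  assumes "s \<in> span E"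
  shows "cv (shear s p) = cv p" "cw (shear s p) = cw p - cv p * Q s - B (cz p) s"
    "cz (shear s p) = cz p + cv p *\<^sub>R s"
  unfolding shear_def
  by (rule coords_eq; simp add: span_add span_scale cz_in_span assms)+

lemma coords_swap [simp]: "cv (swap p) = cw p" "cw (swap p) = cv p" "cz (swap p) = cz p"
  by (simp_all add: swap_def coords_eq cz_in_span)

lemma eq_via_coords: "p = q" if "cv p = cv q" "cw p = cw q" "cz p = cz q"
  by (metis coords that)

lemma boost_inverse: "l > 0 \<Longrightarrow> boost l (boost (1 / l) p) = p" "l > 0 \<Longrightarrow> boost (1 / l) (boost l p) = p"
  by (rule eq_via_coords; simp)+

lemma shear_inverse:
  assumes "s \<in> span E"
  shows "shear s (shear (- s) p) = p" "shear (- s) (shear s p) = p"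
  by (rule eq_via_coords; simp add: coords_shear span_neg assms eq_half_polar B_simps)+

lemma swap_inverse: "swap (swap p) = p"
  by (rule eq_via_coords) simp_all

lemma orthogonal_groupI:
  assumes "linear g" "\<And>x. g (h x) = x" "\<And>x. h (g x) = x" "\<And>x. Q (g x) = Q x"
  shows "g \<in> orthogonal_group Q"
proof -
  have "bij g" using assms(2,3) by (intro o_bij[of h]) (auto simp: fun_eq_iff)
  then show ?thesis using assms by (simp add: orthogonal_group_def)
qed

lemmas linear_coord_simps = linear_add[OF linear_coords(1)] linear_add[OF linear_coords(2)]
  linear_add[OF linear_coords(3)] linear_scale[OF linear_coords(1)] linear_scale[OF linear_coords(2)]
  linear_scale[OF linear_coords(3)]

lemma boost_in_group: "l > 0 \<Longrightarrow> boost l \<in> orthogonal_group Q"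
proof (rule orthogonal_groupI[where h = "boost (1 / l)"])
  show "linear (boost l)"
    by (auto intro!: linearI simp: boost_def linear_coord_simps algebra_simps add_divide_distrib)
  show "l > 0 \<Longrightarrow> Q (boost l x) = Q x" for x
    by (subst (1 2) Q_coords) simp
qed (auto simp: boost_inverse)

lemma shear_in_group:
  assumes "s \<in> span E"
  shows "shear s \<in> orthogonal_group Q"
proof (rule orthogonal_groupI[where h = "shear (- s)"])
  show "linear (shear s)"
    by (auto intro!: linearI simp: shear_def linear_coord_simps B_simps algebra_simps)
  show "Q (shear s x) = Q x" for x
    by (subst (1 2) Q_coords)
       (simp add: coords_shear[OF assms] eq_half_polar B_simps algebra_simps polar_form_commute[of Q s "cz x"] add_divide_distrib)
qed (auto simp: shear_inverse assms)

lemma swap_in_group: "swap \<in> orthogonal_group Q"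
proof (rule orthogonal_groupI[where h = swap])
  show "linear swap"
    by (auto intro!: linearI simp: swap_def linear_coord_simps algebra_simps)
  show "Q (swap x) = Q x" for x
    by (subst (1 2) Q_coords) simp
qed (auto simp: swap_inverse)

lemma uminus_in_group: "uminus \<in> orthogonal_group Q"
  by (rule orthogonal_groupI[where h = uminus])
     (auto intro!: linearI simp: Q_uminus)

section \<open>Norm estimates and continuity in the frame\<close>

lemma inner_sum_E:
  assumes "b \<in> E"
  shows "(\<Sum>e\<in>E. f e *\<^sub>R e) \<bullet> b = f b"
proof -
  have "(\<Sum>e\<in>E. f e *\<^sub>R e) \<bullet> b = (\<Sum>e\<in>E. if e = b then f b else 0)"
    unfolding inner_sum_left
    using assms orthogonal_E norm_E[OF assms]
    by (intro sum.cong) (auto simp: pairwise_def orthogonal_def norm_eq_1)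
  then show ?thesis using finite_E assms by simp
qed

lemma cz_expand: "cz p = (\<Sum>b\<in>E. (cz p \<bullet> b) *\<^sub>R b)"
  using orthonormal_basis_expand[OF orthogonal_E norm_E cz_in_span finite_E] by simp

lemma norm_cz_le:
  fixes r :: real
  assumes "\<And>b. b \<in> E \<Longrightarrow> \<bar>cz p \<bullet> b\<bar> \<le> r"
  shows "norm (cz p) \<le> card E * r"
proof -
  have "norm (cz p) \<le> (\<Sum>b\<in>E. norm ((cz p \<bullet> b) *\<^sub>R b))"
    by (subst cz_expand) (rule norm_sum)
  also have "\<dots> \<le> (\<Sum>b\<in>E. r)"
    using assms norm_E by (intro sum_mono) simp
  finally show ?thesis by simp
qed

lemma bounded_cv: obtains C where "C > 0" "\<And>p. \<bar>cv p\<bar> \<le> C * norm p"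
  using linear_bounded_pos[OF linear_coords(1)] by auto

lemma bounded_cz: obtains C where "C > 0" "\<And>p. norm (cz p) \<le> C * norm p"
  using linear_bounded_pos[OF linear_coords(3)] by auto

lemma bounded_Q: obtains C where "C > 0" "\<And>p. \<bar>Q p\<bar> \<le> C * (norm p)\<^sup>2"
proof -
  obtain C where "C > 0" "\<And>x y. norm (B x y) \<le> norm x * norm y * C"
    using bilinear_polar[unfolded bilinear_conv_bounded_bilinear] bounded_bilinear.pos_bounded by blast
  moreover from this(2)[of p p for p] have "\<bar>Q p\<bar> \<le> C / 2 * (norm p)\<^sup>2" for p
    unfolding eq_half_polar[of p] by (simp add: power2_eq_square algebra_simps)
  ultimately show thesis by (intro that[of "C/2"]) auto
qed

lemma continuous_on_frame [continuous_intros]: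
  "continuous_on S cv" "continuous_on S cw" "continuous_on S cz" "continuous_on S Q"
proof -
  show "continuous_on S cv" "continuous_on S cw" "continuous_on S cz"
    using linear_coords by (simp_all add: linear_continuous_on linear_conv_bounded_linear)
  have "continuous_on S (\<lambda>x. B x x / 2)"
    by (intro continuous_intros bilinear_continuous_on_compose[OF _ _ bilinear_polar]) simp
  then show "continuous_on S Q" by (simp flip: eq_half_polar)
qed

end

text \<open>Nondegeneracy supplies a vector pairing nontrivially with \<open>v\<close>, which is
  then corrected to an isotropic one. The resulting plane and its \<open>Q\<close>-orthogonal
  complement are complementary subspaces, whence the dimension count.\<close>

lemma ex_isotropic_frame:
  fixes Q :: "'a::euclidean_space \<Rightarrow> real"
  assumes bil: "bilinear (polar_form Q)" and half: "\<And>x. Q x = polar_form Q x x / 2"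
    and nondeg: "nondegenerate_form Q" and v: "Q v = 0" "v \<noteq> 0"
  obtains w E where "isotropic_frame Q v w E" "card E + 2 = DIM('a)"
proof -
  let ?B = "polar_form Q"
  note B_simps = bilinear_ladd[OF bil] bilinear_radd[OF bil]
    bilinear_lsub[OF bil] bilinear_rsub[OF bil] bilinear_lmul[OF bil] bilinear_rmul[OF bil]
  obtain u0 where u0: "?B v u0 \<noteq> 0"
    using nondeg v by (auto simp: nondegenerate_form_def)
  define u where "u = (1 / ?B v u0) *\<^sub>R u0"
  \<comment> \<open>Since \<open>v\<close> is isotropic and \<open>B u v = 1\<close>,
    \<open>Q (u - t v) = Q u - t\<close>; the choice \<open>t = Q u\<close> makes \<open>w\<close>
    isotropic without changing its pairing with \<open>v\<close>.\<close>
  define w where "w = u - Q u *\<^sub>R v"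
  have vv: "?B v v = 0" using half[of v] v by simp
  have vu: "?B v u = 1" "?B u v = 1" using u0 by (simp_all add: u_def B_simps polar_form_commute[of Q u0 v])
  have vw: "?B v w = 1" "?B w v = 1" using vv vu by (simp_all add: w_def B_simps)
  have Qw: "Q w = 0"
    using vv vu half[of u] by (subst half) (simp add: w_def B_simps)
  have ww: "?B w w = 0" using half[of w] Qw by simp
  define W where "W = {z. ?B z v = 0 \<and> ?B z w = 0}"
  have W: "subspace W" by (auto simp: subspace_def W_def B_simps bilinear_lzero[OF bil])
  obtain E where E: "pairwise orthogonal E" "\<And>x. x \<in> E \<Longrightarrow> norm x = 1" "independent E"
    "card E = dim W" "span E = W"
    using orthonormal_basis_subspace[OF W] by metis
  have fin: "finite E" using E(3) by (rule independent_imp_finite)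
  let ?S = "span {v, w}"
  have indep: "independent {v, w}"
  proof -
    have "v \<notin> span {w}"
    proof
      assume "v \<in> span {w}"
      then obtain k where "v = k *\<^sub>R w" by (auto simp: span_singleton)
      then have "?B v w = k * ?B w w" by (simp add: B_simps)
      then show False using vw ww by simp
    qed
    moreover have "w \<noteq> 0" using vw by (auto simp: bilinear_rzero[OF bil])
    ultimately show ?thesis by (auto simp: independent_insert)
  qed
  have "v \<noteq> w" using vv vw by auto
  then have dimS: "dim {v, w} = 2" using dim_eq_card_independent[OF indep] by simp
  have S: "?S = {a *\<^sub>R v + b *\<^sub>R w | a b. True}"
    by (simp add: span_insert span_singleton algebra_simps set_eq_iff)
  have int: "?S \<inter> W = {0}"
  proof -
    have "x = 0" if "x \<in> ?S" "x \<in> W" for x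
      using that vv vw ww by (auto simp: S W_def B_simps)
    then show ?thesis using subspace_0[OF W] span_zero[of "{v, w}"] by blast
  qed
  have sum: "{x + y |x y. x \<in> ?S \<and> y \<in> W} = UNIV"
  proof -
    have "\<exists>x y. p = x + y \<and> x \<in> ?S \<and> y \<in> W" for p
      using vv vw ww unfolding S W_def
      by (intro exI[of _ "?B p w *\<^sub>R v + ?B p v *\<^sub>R w"] exI[of _ "p - (?B p w *\<^sub>R v + ?B p v *\<^sub>R w)"])
         (auto simp: B_simps)
    then show ?thesis by blast
  qed
  have "dim W + 2 = DIM('a)"
    using dim_sums_Int[OF subspace_span W, of "{v, w}"] by (simp add: sum int dimS dim_UNIV)
  moreover have "isotropic_frame Q v w E"
    by unfold_locales (use bil half v Qw vw fin E W_def in auto)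
  ultimately show thesis using that E(4) by metis
qed

section \<open>Volume of boxes\<close>

lemma in_image_iff: "(\<And>x. g (h x) = x) \<Longrightarrow> (\<And>x. h (g x) = x) \<Longrightarrow> y \<in> g ` A \<longleftrightarrow> h y \<in> A"
  by (metis image_iff)

text \<open>The doubling law determines \<open>H\<close> at all integral powers of 2. Monotonicity
  interpolates between two consecutive ones, at the price of a factor \<open>2 ^ n\<close> on either
  side.\<close>

lemma power_bounds_of_doubling:
  fixes H :: "real \<Rightarrow> real"
  assumes mono: "\<And>r s. 0 < r \<Longrightarrow> r \<le> s \<Longrightarrow> H r \<le> H s" and nonneg: "H 1 \<ge> 0"
    and double: "\<And>r. 0 < r \<Longrightarrow> H (2 * r) = 2 ^ n * H r" and r: "r > 0"
  shows "(r / 2) ^ n * H 1 \<le> H r" "H r \<le> (2 * r) ^ n * H 1"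
proof -
  have nat1: "H (2 ^ k * r) = (2 ^ k) ^ n * H r" if "r > 0" for k r
  proof (induction k)
    case (Suc k)
    have "H (2 * (2 ^ k * r)) = 2 ^ n * H (2 ^ k * r)" using that by (intro double) simp
    then show ?case using Suc by (simp add: power_mult_distrib mult.assoc)
  qed simp
  have int: "H (2 powi k) = (2 powi k) ^ n * H 1" for k
  proof (cases "k \<ge> 0")
    case True
    then show ?thesis using nat1[of 1 "nat k"] by (simp add: power_int_def)
  next
    case False
    have "H 1 = (2 ^ nat (-k)) ^ n * H (2 powi k)"
      using nat1[of "2 powi k" "nat (-k)"] False by (simp add: power_int_def flip: power_mult_distrib)
    moreover have "(2 powi k) ^ n * (2 ^ nat (-k)) ^ n = (1::real)"
      using False by (simp add: power_int_def flip: power_mult_distrib)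
    ultimately show ?thesis by (metis mult.assoc mult_1)
  qed
  define j where "j = \<lfloor>log 2 r\<rfloor>"
  have "2 powr j \<le> 2 powr log 2 r" "2 powr log 2 r < 2 powr (j + 1)"
    unfolding j_def by auto
  then have j: "2 powi j \<le> r" "r \<le> 2 powi (j + 1)"
    using r by (auto simp flip: powr_real_of_int')
  have p: "2 powi (j + 1) = 2 * (2 powi j :: real)" by (simp add: power_int_add)
  have "(r / 2) ^ n * H 1 \<le> (2 powi j) ^ n * H 1"
    using j p r nonneg by (intro mult_right_mono power_mono) auto
  also have "\<dots> \<le> H r" unfolding int[symmetric] using j by (intro mono) auto
  finally show "(r / 2) ^ n * H 1 \<le> H r" .
  have "H r \<le> H (2 powi (j + 1))" using j r by (intro mono)
  also have "\<dots> \<le> (2 * r) ^ n * H 1"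
    unfolding int using j p r nonneg by (intro mult_right_mono power_mono) auto
  finally show "H r \<le> (2 * r) ^ n * H 1" .
qed

locale invariant_frame = isotropic_frame +
  fixes m :: real and vol :: "'a measure"
  assumes m_nonzero: "m \<noteq> 0" and nondegenerate: "nondegenerate_form Q"
    and invariant: "invariant_measure_on_quadric Q m vol"
begin

lemma closed_quadric: "closed (quadric Q m)"
  unfolding quadric_def by (intro closed_Collect_eq continuous_intros)

lemma in_sets_vol: "A \<in> sets vol \<longleftrightarrow> A \<in> sets borel \<and> A \<subseteq> quadric Q m"
proof -
  have "sets vol = sets (restrict_space borel (quadric Q m))"
    using invariant by (simp add: invariant_measure_on_quadric_def)
  then show ?thesis
    using closed_quadric by (simp add: sets_restrict_space_iff borel_closed conj_commute)
qed

lemma vol_image: "g \<in> orthogonal_group Q \<Longrightarrow> A \<in> sets vol \<Longrightarrow> emeasure vol (g ` A) = emeasure vol A"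
  using invariant by (simp add: invariant_measure_on_quadric_def)

lemma vol_cball_finite: "emeasure vol (quadric Q m \<inter> cball 0 R) < \<infinity>"
  using invariant compact_Int_closed[OF compact_cball closed_quadric, of 0 R]
  by (auto simp: invariant_measure_on_quadric_def Int_commute)

lemma borel_coords [measurable]: "cv \<in> borel_measurable borel" "cz \<in> borel_measurable borel"
  by (auto intro!: borel_measurable_continuous_onI continuous_intros)

text \<open>In the coordinates \<open>(x, z / x)\<close> this is an interval times a cube of side
  \<open>2 * r\<close>. Both are half-open, so that dyadic pieces and subdivided cubes are disjoint
  without any null boundary.\<close>

definition box :: "real \<Rightarrow> real \<Rightarrow> 'a set" where
  "box l r = {p \<in> quadric Q m. l \<le> cv p \<and> cv p < 2 * l \<and>
     (\<forall>b\<in>E. - (r * cv p) \<le> cz p \<bullet> b \<and> cz p \<bullet> b < r * cv p)}"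

lemma Q_group: "g \<in> orthogonal_group Q \<Longrightarrow> Q (g p) = Q p"
  by (simp add: orthogonal_group_def)

lemma quadric_in_sets [measurable]: "quadric Q m \<in> sets borel"
  using closed_quadric by (simp add: borel_closed)

lemma box_in_sets: "box l r \<in> sets vol"
proof -
  have "box l r = quadric Q m \<inter> {p \<in> space borel. l \<le> cv p \<and> cv p < 2 * l} \<inter>
      (\<Inter>b\<in>E. {p \<in> space borel. - (r * cv p) \<le> cz p \<bullet> b \<and> cz p \<bullet> b < r * cv p}) "
    by (auto simp: box_def)
  also have "\<dots> \<in> sets borel"
    by (cases "E = {}") (auto intro!: sets.Int sets.finite_INT finite_E)
  finally show ?thesis by (auto simp: in_sets_vol box_def)
qed

text \<open>A boost multiplies \<open>x\<close> by \<open>l\<close> and keeps \<open>z\<close>, so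
  it divides the radius of the \<open>z / x\<close> cube by \<open>l\<close>. Every box is thereby
  reduced to one at height 1.\<close>

lemma boost_box:
  assumes "l > 0"
  shows "boost l ` box 1 (l * r) = box l r"
proof -
  have "p \<in> box l r \<longleftrightarrow> boost (1 / l) p \<in> box 1 (l * r)" for p
    using assms Q_group[OF boost_in_group, of "1 / l" p]
    by (simp add: box_def quadric_def field_simps)
  then show ?thesis
    using in_image_iff[of "boost l" "boost (1 / l)"] assms by (simp add: boost_inverse set_eq_iff)
qed

lemma vol_box: "l > 0 \<Longrightarrow> emeasure vol (box l r) = emeasure vol (box 1 (l * r))"
  by (metis boost_box boost_in_group box_in_sets vol_image)

text \<open>Solving \<open>x y + Q z = m\<close> for \<open>y\<close> bounds \<open>y / x\<close> by
  a multiple of \<open>1 / x^2 + r^2\<close>, while \<open>z / x\<close> is of order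
  \<open>r\<close>. The point \<open>p / x\<close> differs from \<open>v\<close> by just these two
  components.\<close>

lemma norm_rescaled_le:
  obtains C where "C > 0"
    "\<And>p r. p \<in> quadric Q m \<Longrightarrow> cv p > 0 \<Longrightarrow> r \<ge> 0 \<Longrightarrow> (\<And>b. b \<in> E \<Longrightarrow> \<bar>cz p \<bullet> b\<bar> \<le> r * cv p)
      \<Longrightarrow> norm (p /\<^sub>R cv p - v) \<le> C * (1 / (cv p)\<^sup>2 + r\<^sup>2 + r)"
proof -
  obtain K where K: "K > 0" "\<And>p. \<bar>Q p\<bar> \<le> K * (norm p)\<^sup>2" using bounded_Q by blast
  define n where "n = real (card E)"
  define C where "C = (\<bar>m\<bar> + K * n\<^sup>2) * norm w + n + 1"
  have "C > 0" using K by (simp add: C_def n_def add_nonneg_pos)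
  moreover have "norm (p /\<^sub>R cv p - v) \<le> C * (1 / (cv p)\<^sup>2 + r\<^sup>2 + r)"
    if p: "p \<in> quadric Q m" "cv p > 0" and r: "r \<ge> 0" "\<And>b. b \<in> E \<Longrightarrow> \<bar>cz p \<bullet> b\<bar> \<le> r * cv p" for p r
  proof -
    have z: "norm (cz p) \<le> n * (r * cv p)" using norm_cz_le[of p "r * cv p"] r n_def by simp
    have "\<bar>Q (cz p)\<bar> \<le> K * (n * (r * cv p))\<^sup>2"
      using K(2)[of "cz p"] z K(1) by (meson mult_left_mono norm_ge_zero order.trans power_mono less_imp_le)
    moreover have "cw p * cv p = m - Q (cz p)"
      using Q_coords[of p] p by (simp add: quadric_def algebra_simps)
    moreover have "\<bar>cw p\<bar> * cv p = \<bar>cw p * cv p\<bar>" using p(2) by (simp add: abs_mult)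
    ultimately have "\<bar>cw p\<bar> * cv p \<le> \<bar>m\<bar> + K * (n * (r * cv p))\<^sup>2"
      by linarith
    then have y: "\<bar>cw p\<bar> / cv p \<le> \<bar>m\<bar> / (cv p)\<^sup>2 + K * n\<^sup>2 * r\<^sup>2"
      using p(2) by (simp add: field_simps power2_eq_square)
    have "p /\<^sub>R cv p = v + (cw p / cv p) *\<^sub>R w + cz p /\<^sub>R cv p"
      by (subst (1) coords[of p]) (use p(2) in \<open>simp add: scaleR_add_right field_simps\<close>)
    then have "p /\<^sub>R cv p - v = (cw p / cv p) *\<^sub>R w + cz p /\<^sub>R cv p"
      by (simp add: algebra_simps)
    then have "norm (p /\<^sub>R cv p - v) \<le> norm ((cw p / cv p) *\<^sub>R w) + norm (cz p /\<^sub>R cv p)"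
      using norm_triangle_ineq by metis
    also have "\<dots> = \<bar>cw p\<bar> / cv p * norm w + norm (cz p) / cv p" using p(2) by (simp add: divide_inverse abs_mult mult.commute)
    also have "\<dots> \<le> (\<bar>m\<bar> / (cv p)\<^sup>2 + K * n\<^sup>2 * r\<^sup>2) * norm w + n * r"
      using y z p(2) by (intro add_mono mult_right_mono) (auto simp: field_simps)
    also have "\<dots> \<le> C * (1 / (cv p)\<^sup>2) + C * r\<^sup>2 + C * r"
    proof -
      have "\<bar>m\<bar> * norm w \<le> C" "K * n\<^sup>2 * norm w \<le> C" "n \<le> C"
        using K(1) by (auto simp: C_def n_def algebra_simps)
      then have "\<bar>m\<bar> * norm w * (1 / (cv p)\<^sup>2) \<le> C * (1 / (cv p)\<^sup>2)"
          "K * n\<^sup>2 * norm w * r\<^sup>2 \<le> C * r\<^sup>2" "n * r \<le> C * r"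
        using r(1) by (auto intro!: mult_right_mono divide_right_mono)
      then show ?thesis by (simp add: algebra_simps)
    qed
    finally show ?thesis by (simp add: algebra_simps)
  qed
  ultimately show thesis by (rule that)
qed

text \<open>With \<open>x\<close> between 1 and 2 the preceding estimate bounds the box, which then
  lies in a compact piece of the quadric.\<close>

lemma vol_box_finite:
  assumes r: "r \<ge> 0"
  shows "emeasure vol (box 1 r) < \<infinity>"
proof -
  obtain C where C: "C > 0" "\<And>p r. p \<in> quadric Q m \<Longrightarrow> cv p > 0 \<Longrightarrow> r \<ge> 0 \<Longrightarrow>
      (\<And>b. b \<in> E \<Longrightarrow> \<bar>cz p \<bullet> b\<bar> \<le> r * cv p) \<Longrightarrow> norm (p /\<^sub>R cv p - v) \<le> C * (1 / (cv p)\<^sup>2 + r\<^sup>2 + r)"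
    using norm_rescaled_le by blast
  define M where "M = norm v + C * (1 + r\<^sup>2 + r)"
  have "norm p \<le> 2 * M" if p: "p \<in> box 1 r" for p
  proof -
    have c: "1 \<le> cv p" "cv p < 2" using p by (auto simp: box_def)
    have "norm (p /\<^sub>R cv p - v) \<le> C * (1 / (cv p)\<^sup>2 + r\<^sup>2 + r)"
      using p r by (intro C) (force simp: box_def abs_le_iff)+
    also have "\<dots> \<le> C * (1 + r\<^sup>2 + r)" using c C(1) by (intro mult_left_mono add_right_mono) auto
    finally have "norm (p /\<^sub>R cv p) \<le> M" using norm_triangle_sub[of "p /\<^sub>R cv p" v] by (simp add: M_def)
    then have "norm p \<le> cv p * M" using c by (simp add: field_simps)
    also have "\<dots> \<le> 2 * M" using c C(1) r by (intro mult_right_mono) (auto simp: M_def)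
    finally show ?thesis .
  qed
  then have "box 1 r \<subseteq> quadric Q m \<inter> cball 0 (2 * M)" by (auto simp: box_def)
  then have "emeasure vol (box 1 r) \<le> emeasure vol (quadric Q m \<inter> cball 0 (2 * M))"
    by (rule emeasure_mono) (auto simp: in_sets_vol closed_quadric borel_closed)
  then show ?thesis using vol_cball_finite[of "2 * M"] by (rule le_less_trans)
qed

lemma shear_box:
  assumes s: "s \<in> span E"
  shows "p \<in> shear s ` box 1 r \<longleftrightarrow> p \<in> quadric Q m \<and> 1 \<le> cv p \<and> cv p < 2 \<and>
     (\<forall>b\<in>E. (s \<bullet> b - r) * cv p \<le> cz p \<bullet> b \<and> cz p \<bullet> b < (s \<bullet> b + r) * cv p)"
proof -
  have "p \<in> shear s ` box 1 r \<longleftrightarrow> shear (- s) p \<in> box 1 r"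
    by (rule in_image_iff) (simp_all add: shear_inverse s)
  moreover have "Q (shear (- s) p) = Q p"
    by (intro Q_group shear_in_group span_neg s)
  ultimately show ?thesis
    by (auto simp: box_def quadric_def coords_shear span_neg s inner_diff_left algebra_simps)
qed

text \<open>A cube of radius \<open>2 * r\<close> is tiled by \<open>2 ^ card E\<close> cubes of
  radius \<open>r\<close> with centre coordinates \<open>r\<close> or \<open>- r\<close>. The shears
  realise these translations inside the orthogonal group, so all tiles have equal volume.\<close>

lemma vol_box_double:
  assumes r: "r > 0"
  shows "emeasure vol (box 1 (2 * r)) = 2 ^ card E * emeasure vol (box 1 r)"
proof -
  \<comment> \<open>Sign vectors are extensional functions on \<open>E\<close>, so two different
    ones differ at some \<open>b\<close> in \<open>E\<close>, and there the tiles are separated by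
    the hyperplane \<open>cz p \<bullet> b = 0\<close>.\<close>
  define I where "I = (\<Pi>\<^sub>E b\<in>E. {-1, 1::real})"
  define s where "s \<epsilon> = (\<Sum>b\<in>E. (\<epsilon> b * r) *\<^sub>R b)" for \<epsilon> :: "'a \<Rightarrow> real"
  define A where "A \<epsilon> = shear (s \<epsilon>) ` box 1 r" for \<epsilon>
  have s_span: "s \<epsilon> \<in> span E" for \<epsilon> unfolding s_def by (intro span_sum span_scale span_base)
  have A: "p \<in> A \<epsilon> \<longleftrightarrow> p \<in> quadric Q m \<and> 1 \<le> cv p \<and> cv p < 2 \<and>
      (\<forall>b\<in>E. (\<epsilon> b - 1) * (r * cv p) \<le> cz p \<bullet> b \<and> cz p \<bullet> b < (\<epsilon> b + 1) * (r * cv p))" for p \<epsilon>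
    unfolding A_def shear_box[OF s_span]
    by (auto simp: s_def inner_sum_E algebra_simps)
  have finI: "finite I" and cardI: "card I = 2 ^ card E"
    using finite_E by (auto simp: I_def finite_PiE card_PiE numeral_2_eq_2)
  have A_sets: "A \<epsilon> \<in> sets vol" for \<epsilon>
  proof -
    have "A \<epsilon> = quadric Q m \<inter> {p \<in> space borel. 1 \<le> cv p \<and> cv p < 2} \<inter> (\<Inter>b\<in>E. {p \<in> space borel.
        (\<epsilon> b - 1) * (r * cv p) \<le> cz p \<bullet> b \<and> cz p \<bullet> b < (\<epsilon> b + 1) * (r * cv p)})"
      by (auto simp: A)
    also have "\<dots> \<in> sets borel"
      by (cases "E = {}") (auto intro!: sets.Int sets.finite_INT finite_E)
    finally show ?thesis by (auto simp: in_sets_vol A)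
  qed
  have "disjoint_family_on A I"
  proof (unfold disjoint_family_on_def, intro ballI impI)
    fix \<epsilon> \<delta> assume *: "\<epsilon> \<in> I" "\<delta> \<in> I" "\<epsilon> \<noteq> \<delta>"
    then obtain b where b: "b \<in> E" "\<epsilon> b \<noteq> \<delta> b" unfolding I_def by (metis PiE_ext)
    moreover have "\<epsilon> b \<in> {-1, 1}" "\<delta> b \<in> {-1, 1}" using * b by (auto simp: I_def)
    ultimately have "\<epsilon> b = -1 \<and> \<delta> b = 1 \<or> \<epsilon> b = 1 \<and> \<delta> b = -1" by auto
    with b show "A \<epsilon> \<inter> A \<delta> = {}" by (force simp: A)
  qed
  then have "(\<Sum>\<epsilon>\<in>I. emeasure vol (A \<epsilon>)) = emeasure vol (\<Union>\<epsilon>\<in>I. A \<epsilon>)"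
    using A_sets finI by (intro sum_emeasure) auto
  moreover have "(\<Union>\<epsilon>\<in>I. A \<epsilon>) = box 1 (2 * r)"
  proof (intro set_eqI iffI)
    fix p assume "p \<in> (\<Union>\<epsilon>\<in>I. A \<epsilon>)"
    then obtain \<epsilon> where \<epsilon>: "\<epsilon> \<in> I" "p \<in> A \<epsilon>" by auto
    have "- (2 * r * cv p) \<le> cz p \<bullet> b \<and> cz p \<bullet> b < 2 * r * cv p" if "b \<in> E" for b
    proof -
      have "\<epsilon> b = -1 \<or> \<epsilon> b = 1" using \<epsilon>(1) that by (auto simp: I_def)
      moreover have "0 < r * cv p" using \<epsilon>(2) r by (auto simp: A)
      ultimately show ?thesis using \<epsilon>(2) that by (auto simp: A)
    qed
    then show "p \<in> box 1 (2 * r)" using \<epsilon> by (auto simp: A box_def)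
  next
    fix p assume p: "p \<in> box 1 (2 * r)"
    \<comment> \<open>The value 0 goes to the positive side, matching the half-open tiles.\<close>
    define \<epsilon> where "\<epsilon> = (\<lambda>b\<in>E. if cz p \<bullet> b < 0 then -1 else 1 :: real)"
    have "\<epsilon> \<in> I" by (auto simp: \<epsilon>_def I_def)
    moreover have "p \<in> A \<epsilon>" using p by (auto simp: A box_def \<epsilon>_def)
    ultimately show "p \<in> (\<Union>\<epsilon>\<in>I. A \<epsilon>)" by blast
  qed
  moreover have "emeasure vol (A \<epsilon>) = emeasure vol (box 1 r)" for \<epsilon>
    unfolding A_def by (intro vol_image shear_in_group s_span box_in_sets)
  ultimately show ?thesis by (simp add: cardI)
qed

text \<open>A boost turns the box into one at height 1 and radius \<open>l * r\<close>, where the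
  doubling law in the radius applies.\<close>

lemma vol_box_bounds:
  assumes "l > 0" "r > 0"
  defines "h \<equiv> measure vol (box 1 1)"
  shows "ennreal ((l * r / 2) ^ card E * h) \<le> emeasure vol (box l r)"
    "emeasure vol (box l r) \<le> ennreal ((2 * (l * r)) ^ card E * h)"
proof -
  define H where "H r = measure vol (box 1 r)" for r
  have em: "emeasure vol (box 1 r) = ennreal (H r)" if "r > 0" for r
    using vol_box_finite[of r] that by (simp add: H_def emeasure_eq_ennreal_measure less_top)
  have mono: "H r \<le> H s" if "0 < r" "r \<le> s" for r s
  proof -
    have "box 1 r \<subseteq> box 1 s"
    proof
      fix p assume p: "p \<in> box 1 r"
      then have "r * cv p \<le> s * cv p" using that by (intro mult_right_mono) (auto simp: box_def)
      moreover have "- (r * cv p) \<le> cz p \<bullet> b \<and> cz p \<bullet> b < r * cv p" if "b \<in> E" for b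
        using p that by (simp add: box_def)
      ultimately have "- (s * cv p) \<le> cz p \<bullet> b \<and> cz p \<bullet> b < s * cv p" if "b \<in> E" for b
        using that by (meson le_less_trans less_le_trans neg_le_iff_le order_trans)
      then show "p \<in> box 1 s" using p by (simp add: box_def)
    qed
    then have "emeasure vol (box 1 r) \<le> emeasure vol (box 1 s)" by (intro emeasure_mono box_in_sets)
    then show ?thesis using that by (simp add: em H_def)
  qed
  have double: "H (2 * r) = 2 ^ card E * H r" if "r > 0" for r
  proof -
    have "(2 :: ennreal) ^ card E = ennreal (2 ^ card E)"
      by (metis ennreal_numeral ennreal_power zero_le_numeral)
    then show ?thesis
      using vol_box_double[OF that] by (simp add: H_def measure_def enn2real_mult)
  qed
  have "H 1 \<ge> 0" by (simp add: H_def)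
  moreover have "l * r > 0" using assms by simp
  ultimately have bounds: "(l * r / 2) ^ card E * H 1 \<le> H (l * r)" "H (l * r) \<le> (2 * (l * r)) ^ card E * H 1"
    using power_bounds_of_doubling[of H "card E" "l * r"] mono double by blast+
  show "ennreal ((l * r / 2) ^ card E * h) \<le> emeasure vol (box l r)"
    "emeasure vol (box l r) \<le> ennreal ((2 * (l * r)) ^ card E * h)"
    using bounds[THEN ennreal_leI] by (simp_all only: vol_box[OF assms(1)] em[OF \<open>l * r > 0\<close>] h_def H_def)
qed

text \<open>If the unit box is null, then so is the set of \<open>p\<close> with \<open>B p w \<noteq> 0\<close>; moving \<open>w\<close> by the orthogonal group to a
  spanning set of vectors then makes the whole quadric null.\<close>

lemma vol_unit_box_pos: "measure vol (box 1 1) > 0"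
proof (rule ccontr)
  assume "\<not> ?thesis"
  then have "measure vol (box 1 1) = 0" using measure_nonneg[of vol "box 1 1"] by linarith
  then have null: "box l r \<in> null_sets vol" if "l > 0" "r > 0" for l r
    using vol_box_bounds(2)[OF that] by (auto intro: null_setsI box_in_sets)
  \<comment> \<open>\<open>H u\<close> is the part of the quadric off the hyperplane polar to
    \<open>u\<close>; \<open>H w\<close> is where \<open>x\<close> does not vanish.\<close>
  define H where "H u = {p \<in> quadric Q m. B p u \<noteq> 0}" for u
  define P where "P = {p \<in> quadric Q m. cv p > 0}"
  \<comment> \<open>A rational \<open>l\<close> strictly between \<open>x / 2\<close> and
    \<open>x\<close> and an integer \<open>r\<close> above \<open>norm z / x\<close> place every
    point with \<open>x > 0\<close> in one of countably many null boxes.\<close>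
  have P_cover: "P \<subseteq> (\<Union>l\<in>{l\<in>\<rat>. l > 0}. \<Union>r\<in>{0::nat<..}. box l (real r))"
  proof
    fix p assume p: "p \<in> P"
    then obtain l where l: "l \<in> \<rat>" "cv p / 2 < l" "l < cv p"
      using Rats_dense_in_real[of "cv p / 2" "cv p"] by (auto simp: P_def)
    obtain r :: nat where r: "norm (cz p) / cv p < r" using reals_Archimedean2 by blast
    have cv: "cv p > 0" using p by (simp add: P_def)
    have "\<bar>cz p \<bullet> b\<bar> < r * cv p" if "b \<in> E" for b
      using Cauchy_Schwarz_ineq2[of "cz p" b] norm_E[OF that] r cv by (simp add: field_simps)
    then have "p \<in> box l r" using l p by (force simp: box_def P_def abs_less_iff)
    moreover have "r > 0" using r cv by (metis divide_nonneg_pos gr0I norm_ge_zero not_le of_nat_0)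
    moreover have "l > 0" using l cv by linarith
    ultimately show "p \<in> (\<Union>l\<in>{l\<in>\<rat>. l > 0}. \<Union>r\<in>{0::nat<..}. box l (real r))" using l by blast
  qed
  have cover_null: "(\<Union>l\<in>{l\<in>\<rat>. l > 0}. \<Union>r\<in>{0::nat<..}. box l (real r)) \<in> null_sets vol"
    using null countable_subset[OF _ countable_rat, of "{l\<in>\<rat>. l > (0::real)}"]
    by (intro null_sets_UN') auto
  have P: "P \<in> sets vol" unfolding in_sets_vol
  proof
    have "P = quadric Q m \<inter> {p \<in> space borel. cv p > 0}" by (auto simp: P_def)
    then show "P \<in> sets borel" by simp
  qed (auto simp: P_def)
  have Pnull: "P \<in> null_sets vol" by (rule null_sets_subset[OF cover_null P P_cover])
  have "p \<in> uminus ` P \<longleftrightarrow> p \<in> quadric Q m \<and> cv p < 0" for p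
    using in_image_iff[of uminus uminus p P]
    by (simp add: P_def quadric_def Q_uminus linear_neg[OF linear_coords(1)])
  then have minus_P: "uminus ` P = {p \<in> quadric Q m. cv p < 0}" by blast
  have "emeasure vol (uminus ` P) = 0"
    using vol_image[OF uminus_in_group P] Pnull by auto
  moreover have "uminus ` P \<in> sets vol"
  proof -
    have "uminus ` P = quadric Q m \<inter> {p \<in> space borel. cv p < 0}" using minus_P by auto
    then show ?thesis by (auto simp: in_sets_vol)
  qed
  moreover have "H w = P \<union> uminus ` P"
    unfolding minus_P by (auto simp: H_def P_def cv_def)
  ultimately have Hw: "H w \<in> null_sets vol" using Pnull by auto
  have H_sets: "H u \<in> sets vol" for u
  proof -
    have [measurable]: "(\<lambda>p. B p u) \<in> borel_measurable borel"
      by (intro borel_measurable_continuous_onI bilinear_continuous_on_compose[OF _ _ bilinear_polar])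
         (rule continuous_on_id continuous_on_const)+
    have "H u = quadric Q m \<inter> {p \<in> space borel. B p u \<noteq> 0}"
      by (auto simp: H_def)
    then show ?thesis by (auto simp: in_sets_vol)
  qed
  \<comment> \<open>Orthogonal maps preserve the polar form, so \<open>g\<close> carries
    \<open>H u\<close> onto \<open>H (g u)\<close>.\<close>
  have Hg: "H (g u) \<in> null_sets vol" if "g \<in> orthogonal_group Q" "H u \<in> null_sets vol" for g u
  proof -
    have g: "linear g" "bij g" "\<And>x. Q (g x) = Q x" using that(1) by (auto simp: orthogonal_group_def)
    have B: "B (g x) (g y) = B x y" for x y by (simp add: polar_form_def g(3) flip: linear_add[OF g(1)])
    have "H (g u) = g ` H u"
    proof (intro set_eqI iffI)
      fix p assume p: "p \<in> H (g u)"
      obtain q where "p = g q" using g(2) by (metis bij_pointE)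
      then show "p \<in> g ` H u" using p by (auto simp: H_def B quadric_def g)
    qed (auto simp: H_def B quadric_def g)
    then show ?thesis using vol_image[OF that(1) H_sets[of u]] that(2) H_sets[of "g u"] by (intro null_setsI) auto
  qed
  have "cv w = 0" "cw w = 1" "cz w = 0" by (simp_all add: cz_def cv_def cw_def)
  then have "swap w = v" by (simp add: swap_def)
  with Hg[OF swap_in_group Hw] have Hv: "H v \<in> null_sets vol" by simp
  have Hs: "H (shear b v) \<in> null_sets vol" if "b \<in> E" for b
    using that by (intro Hg[OF shear_in_group Hv] span_base)
  \<comment> \<open>A point missed by all these sets is orthogonal to \<open>w\<close>,
    \<open>v\<close> and each \<open>shear b v = v - Q b w + b\<close>, hence to the whole space.
    Nondegeneracy makes it 0, which is not on the quadric as \<open>m\<close> is nonzero.\<close>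
  have "quadric Q m \<subseteq> H w \<union> H v \<union> (\<Union>b\<in>E. H (shear b v))"
  proof
    fix p assume p: "p \<in> quadric Q m"
    show "p \<in> H w \<union> H v \<union> (\<Union>b\<in>E. H (shear b v))"
    proof (rule ccontr)
      assume "\<not> ?thesis"
      then have 0: "B p w = 0" "B p v = 0" "\<And>b. b \<in> E \<Longrightarrow> B p (shear b v) = 0"
        using p by (auto simp: H_def)
      have "cv v = 1" "cw v = 0" "cz v = 0" by (simp_all add: cz_def cv_def cw_def)
      then have "B p b = 0" if "b \<in> E" for b
        using 0(3)[OF that] 0(1,2) by (simp add: shear_def B_simps)
      then have E0: "B p z = 0" if "z \<in> span E" for z
        using linear_eq_0_on_span[OF _ _ that, of "B p"] bilinear_polar
        by (simp add: bilinear_def \<open>\<And>b. b \<in> E \<Longrightarrow> B p b = 0\<close>)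
      have "B p q = 0" for q
        by (subst coords) (simp add: B_simps 0 E0 cz_in_span)
      then have "p = 0" using nondegenerate by (simp add: nondegenerate_form_def)
      then show False using p m_nonzero eq_half_polar[of 0] by (simp add: quadric_def B_simps)
    qed
  qed
  moreover have "H w \<union> H v \<union> (\<Union>b\<in>E. H (shear b v)) \<in> null_sets vol"
    using Hw Hv Hs finite_E by (intro null_sets.Un null_sets.finite_UN) auto
  ultimately have "emeasure vol (quadric Q m) = 0"
    using null_sets_subset[of _ vol "quadric Q m"] in_sets_vol[of "quadric Q m"] by auto
  then show False using invariant by (simp add: invariant_measure_on_quadric_def)
qed

end

section \<open>The cone between unions of boxes\<close>

text \<open>Normalising moves \<open>q\<close> by the distance of \<open>norm q\<close> from 1,
  which is at most \<open>norm (q - v)\<close> because \<open>v\<close> is a unit vector.\<close>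

lemma norm_normalize_diff_le:
  fixes q v :: "'a::real_normed_vector"
  assumes "norm v = 1"
  shows "norm (q /\<^sub>R norm q - v) \<le> 2 * norm (q - v)"
proof (cases "q = 0")
  case False
  then have "norm (q /\<^sub>R norm q - q) = \<bar>1 / norm q - 1\<bar> * norm q"
    by (metis (no_types, lifting) divide_inverse mult_1 norm_scaleR scaleR_left_diff_distrib scaleR_one)
  also have "\<dots> = \<bar>1 - norm q\<bar>" using False by (simp add: field_simps flip: abs_mult_pos)
  also have "\<dots> \<le> norm (q - v)" using assms norm_triangle_ineq3[of q v] by (simp add: abs_minus_commute)
  finally show ?thesis using norm_triangle_ineq[of "q /\<^sub>R norm q - q" "q - v"] by simp
qed (use assms in simp)

text \<open>Taking \<open>h = 1\<close> gives \<open>c \<ge> 1\<close>. The condition relating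
  \<open>s\<close> and \<open>t\<close> is symmetric, so it bounds \<psi> from below as well as from
  above.\<close>

lemma quasi_conformalE:
  assumes "quasi_conformal \<psi>" "\<forall>t>0. \<psi> t > 0"
  obtains c where "c \<ge> 1" "\<And>s t. 0 < t \<Longrightarrow> t / 2 \<le> s \<Longrightarrow> s \<le> 2 * t \<Longrightarrow> \<psi> s \<le> c * \<psi> t"
proof -
  obtain c where c: "c > 0" "\<And>t h. t > 0 \<Longrightarrow> h \<in> {1/2..2} \<Longrightarrow> \<psi> (h * t) \<le> c * \<psi> t"
    using assms(1) by (auto simp: quasi_conformal_def)
  have "\<psi> 1 \<le> c * \<psi> 1" using c(2)[of 1 1] by simp
  then have "c \<ge> 1" using assms(2) by simp
  moreover have "\<psi> s \<le> c * \<psi> t" if "0 < t" "t / 2 \<le> s" "s \<le> 2 * t" for s t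
    using c(2)[of t "s / t"] that by (simp add: field_simps)
  ultimately show thesis by (rule that)
qed

context invariant_frame
begin

text \<open>Here \<open>1 / l^2 + r\<close> controls the distance from \<open>p / x\<close> to
  \<open>v\<close>. The minimum with 1 ensures \<open>r^2 \<le> r\<close> and keeps
  \<open>norm p\<close> comparable to \<open>x\<close>.\<close>

lemma box_subset_cone:
  assumes v: "norm v = 1" and \<psi>: "\<forall>t>0. \<psi> t > 0" "quasi_conformal \<psi>"
  obtains \<epsilon> where "\<epsilon> > 0" "\<And>l r. l > 0 \<Longrightarrow> 0 \<le> r \<Longrightarrow> 1 / l\<^sup>2 + r \<le> \<epsilon> * min (\<psi> l) 1
    \<Longrightarrow> box l r \<subseteq> approximation_cone Q m v \<psi>"
proof -
  obtain c where c: "c \<ge> 1" "\<And>s t. 0 < t \<Longrightarrow> t / 2 \<le> s \<Longrightarrow> s \<le> 2 * t \<Longrightarrow> \<psi> s \<le> c * \<psi> t"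
    using quasi_conformalE[OF \<psi>(2,1)] by blast
  obtain C where C: "C > 0" "\<And>p r. p \<in> quadric Q m \<Longrightarrow> cv p > 0 \<Longrightarrow> r \<ge> 0 \<Longrightarrow>
      (\<And>b. b \<in> E \<Longrightarrow> \<bar>cz p \<bullet> b\<bar> \<le> r * cv p) \<Longrightarrow> norm (p /\<^sub>R cv p - v) \<le> C * (1 / (cv p)\<^sup>2 + r\<^sup>2 + r)"
    using norm_rescaled_le by blast
  \<comment> \<open>Of the 8, one factor 2 absorbs the estimate of \<open>p / x\<close>, one the
    normalisation, and one leaves the inequality strict. The \<open>c^2\<close> pays for passing
    from \<open>l\<close> to \<open>x\<close> and from \<open>x\<close> to
    \<open>norm p\<close>.\<close>
  define \<epsilon> where "\<epsilon> = min 1 (1 / (8 * C * c\<^sup>2))"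
  have "p \<in> approximation_cone Q m v \<psi>"
    if l: "l > 0" "0 \<le> r" "1 / l\<^sup>2 + r \<le> \<epsilon> * min (\<psi> l) 1" and p: "p \<in> box l r" for l r p
  proof -
    have cv: "l \<le> cv p" "cv p < 2 * l" "cv p > 0" and pq: "p \<in> quadric Q m" using p l by (auto simp: box_def)
    define q where "q = p /\<^sub>R cv p"
    have \<psi>l: "\<psi> l > 0" using \<psi> l by simp
    have "\<epsilon> * min (\<psi> l) 1 \<le> 1 * 1"
      using \<psi>l C c(1) by (intro mult_mono) (auto simp: \<epsilon>_def)
    moreover have "1 / l\<^sup>2 \<ge> 0" by simp
    ultimately have "r \<le> 1" using l by linarith
    then have r2: "r\<^sup>2 \<le> r" using l(2) by (simp add: power2_eq_square mult_left_le)
    have "norm (q - v) \<le> C * (1 / (cv p)\<^sup>2 + r\<^sup>2 + r)"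
      unfolding q_def using p l(2) by (intro C(2) pq cv) (force simp: box_def abs_le_iff)+
    also have "\<dots> \<le> C * (2 * (1 / l\<^sup>2 + r))"
    proof -
      have "1 / (cv p)\<^sup>2 \<le> 1 / l\<^sup>2" using cv l by (intro divide_left_mono power_mono) auto
      then have "1 / (cv p)\<^sup>2 \<le> 1 / l\<^sup>2 + 1 / l\<^sup>2" by (intro add_increasing) simp_all
      then have "1 / (cv p)\<^sup>2 + r\<^sup>2 + r \<le> 1 / l\<^sup>2 + 1 / l\<^sup>2 + r + r"
        using r2 by (intro add_mono) simp_all
      also have "\<dots> = 2 * (1 / l\<^sup>2 + r)" by simp
      finally have "1 / (cv p)\<^sup>2 + r\<^sup>2 + r \<le> 2 * (1 / l\<^sup>2 + r)" .
      then show ?thesis using C(1) by (intro mult_left_mono) auto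
    qed
    also have "\<dots> \<le> C * (2 * (1 / (8 * C * c\<^sup>2) * min (\<psi> l) 1))"
    proof -
      have "\<epsilon> * min (\<psi> l) 1 \<le> 1 / (8 * C * c\<^sup>2) * min (\<psi> l) 1"
        using \<psi>l by (intro mult_right_mono) (auto simp: \<epsilon>_def)
      then show ?thesis using C(1) l(3) by (intro mult_left_mono) auto
    qed
    also have "\<dots> = min (\<psi> l) 1 / (4 * c\<^sup>2)" using C(1) c(1) by (simp add: field_simps)
    finally have qv: "norm (q - v) \<le> min (\<psi> l) 1 / (4 * c\<^sup>2)" .
    also have "\<dots> \<le> 1 / (4 * 1)"
      using c(1) \<psi>l one_le_power[of c 2] by (intro frac_le) auto
    finally have q1: "\<bar>norm q - 1\<bar> \<le> 1 / 4" using norm_triangle_ineq3[of q v] v by linarith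
    have np: "norm p = norm q * cv p" using cv by (simp add: q_def)
    have "radial_projection p = q /\<^sub>R norm q"
      using cv by (simp add: radial_projection_def q_def)
    then have "norm (radial_projection p - v) \<le> 2 * norm (q - v)"
      using norm_normalize_diff_le[OF v, of q] by simp
    also have "\<dots> \<le> 2 * (\<psi> l / (4 * c\<^sup>2))"
      using qv by (meson divide_right_mono min.cobounded1 mult_left_mono order_trans zero_le_numeral zero_le_power2 mult_nonneg_nonneg)
    also have "\<dots> < \<psi> l / c\<^sup>2" using \<psi>l c(1) by (simp add: field_simps)
    also have "\<dots> \<le> \<psi> (norm p)"
    proof -
      have "\<psi> l \<le> c * \<psi> (cv p)" using cv l by (intro c(2)) auto
      also have "\<psi> (cv p) \<le> c * \<psi> (norm p)"
      proof (rule c(2))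
        have "1 / 2 * cv p \<le> norm p" "norm p \<le> 2 * cv p" "0 < norm q"
          unfolding np using q1 cv(3) by (intro mult_right_mono; linarith)+ (use q1 in linarith)
        then show "0 < norm p" "norm p / 2 \<le> cv p" "cv p \<le> 2 * norm p" using cv(3) by (auto simp: np)
      qed
      finally have "\<psi> l \<le> c * (c * \<psi> (norm p))" using c(1) by (simp add: mult_left_mono)
      then show ?thesis using c(1) by (simp add: field_simps power2_eq_square)
    qed
    finally show ?thesis using pq by (simp add: approximation_cone_def)
  qed
  moreover have "\<epsilon> > 0" using C c(1) by (simp add: \<epsilon>_def)
  ultimately show thesis using that by blast
qed

text \<open>When \<psi> is small, the radial projection is close to \<open>v\<close>, where
  \<open>cv\<close> is 1 and \<open>cz\<close> is 0. Boundedness of these linear maps then yields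
  the size of \<open>x\<close> and of \<open>z\<close>.\<close>

lemma cone_subset_box:
  assumes v: "norm v = 1" and \<psi>: "\<forall>t>0. \<psi> t > 0" "quasi_conformal \<psi>"
  obtains K \<delta> where "K > 0" "\<delta> > 0"
    "\<And>p l. p \<in> approximation_cone Q m v \<psi> \<Longrightarrow> \<psi> (norm p) \<le> \<delta> \<Longrightarrow> l > 0 \<Longrightarrow> l \<le> cv p \<Longrightarrow> cv p < 2 * l \<Longrightarrow>
      p \<in> box l (K * \<psi> l)"
    "\<And>p. p \<in> approximation_cone Q m v \<psi> \<Longrightarrow> \<psi> (norm p) \<le> \<delta> \<Longrightarrow> norm p / 2 \<le> cv p"
proof -
  obtain c where c: "c \<ge> 1" "\<And>s t. 0 < t \<Longrightarrow> t / 2 \<le> s \<Longrightarrow> s \<le> 2 * t \<Longrightarrow> \<psi> s \<le> c * \<psi> t"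
    using quasi_conformalE[OF \<psi>(2,1)] by blast
  obtain C1 where C1: "C1 > 0" "\<And>p. \<bar>cv p\<bar> \<le> C1 * norm p" using bounded_cv by blast
  obtain C2 where C2: "C2 > 0" "\<And>p. norm (cz p) \<le> C2 * norm p" using bounded_cz by blast
  have cvv: "cv v = 1" "cz v = 0" by (simp_all add: cv_def cz_def cw_def)
  \<comment> \<open>The threshold \<open>1 / (2 * C1)\<close> makes \<open>cv p / norm p\<close>
    differ from 1 by at most one half.\<close>
  have half: "norm p / 2 \<le> cv p \<and> cv p \<le> 2 * norm p \<and> norm p > 0 \<and>
      (\<forall>b\<in>E. \<bar>cz p \<bullet> b\<bar> < C2 * norm p * \<psi> (norm p))"
    if p: "p \<in> approximation_cone Q m v \<psi>" "\<psi> (norm p) \<le> 1 / (2 * C1)" for p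
  proof -
    have "p \<noteq> 0"
      using p(1) m_nonzero eq_half_polar[of 0] by (auto simp: approximation_cone_def quadric_def B_simps)
    then have np: "norm p > 0" by simp
    define e where "e = p /\<^sub>R norm p - v"
    have e: "norm e < \<psi> (norm p)" using p(1) by (simp add: e_def approximation_cone_def radial_projection_def)
    have "cv e = cv p / norm p - 1" "cz e = cz p /\<^sub>R norm p"
      by (simp_all add: e_def linear_diff[OF linear_coords(1)] linear_diff[OF linear_coords(3)]
            linear_coord_simps cvv divide_inverse mult.commute)
    note ce = this
    have "\<bar>cv p / norm p - 1\<bar> \<le> C1 * norm e" using C1(2)[of e] ce by simp
    also have "\<dots> \<le> C1 * (1 / (2 * C1))" using e p(2) C1(1) by (intro mult_left_mono) auto
    finally have "\<bar>cv p / norm p - 1\<bar> \<le> 1 / 2" using C1(1) by simp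
    then have "1 / 2 \<le> cv p / norm p" "cv p / norm p \<le> 2" by linarith+
    then have 1: "norm p / 2 \<le> cv p" "cv p \<le> 2 * norm p" using np by (simp_all add: field_simps)
    have "\<bar>cz p \<bullet> b\<bar> < C2 * norm p * \<psi> (norm p)" if "b \<in> E" for b
    proof -
      have "\<bar>cz p \<bullet> b\<bar> \<le> norm (cz p)" using Cauchy_Schwarz_ineq2[of "cz p" b] norm_E[OF that] by simp
      also have "\<dots> = norm p * norm (cz e)" using ce np by simp
      also have "\<dots> \<le> norm p * (C2 * norm e)" using C2(2) by (intro mult_left_mono) auto
      also have "\<dots> < norm p * (C2 * \<psi> (norm p))" using e np C2(1) by simp
      finally show ?thesis by (simp add: mult_ac)
    qed
    then show ?thesis using 1 np by blast
  qed
  \<comment> \<open>The 2 comes from \<open>norm p \<le> 2 * cv p\<close>, and \<open>c^2\<close>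
    from comparing \<psi> at \<open>norm p\<close>, at \<open>cv p\<close> and at
    \<open>l\<close>.\<close>
  have "p \<in> box l (2 * C2 * c\<^sup>2 * \<psi> l)"
    if p: "p \<in> approximation_cone Q m v \<psi>" "\<psi> (norm p) \<le> 1 / (2 * C1)"
      and l: "l > 0" "l \<le> cv p" "cv p < 2 * l" for p l
  proof -
    note h = half[OF p]
    have "cv p > 0" using l by linarith
    then have "\<psi> (norm p) \<le> c * \<psi> (cv p)"
      using h \<open>cv p > 0\<close> by (intro c(2)) auto
    also have "\<psi> (cv p) \<le> c * \<psi> l" using l by (intro c(2)) auto
    finally have \<psi>p: "\<psi> (norm p) \<le> c\<^sup>2 * \<psi> l" using c(1) by (simp add: mult_left_mono power2_eq_square mult.assoc)
    have "\<bar>cz p \<bullet> b\<bar> < 2 * C2 * c\<^sup>2 * \<psi> l * cv p" if "b \<in> E" for b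
    proof -
      have "\<bar>cz p \<bullet> b\<bar> < C2 * norm p * \<psi> (norm p)" using h that by blast
      also have "\<dots> \<le> C2 * (2 * cv p) * (c\<^sup>2 * \<psi> l)"
        using h \<psi>p C2(1) \<psi> l by (intro mult_mono) (auto intro!: less_imp_le)
      finally show ?thesis by (simp add: mult_ac)
    qed
    then have "\<forall>b\<in>E. - (2 * C2 * c\<^sup>2 * \<psi> l * cv p) \<le> cz p \<bullet> b \<and> cz p \<bullet> b < 2 * C2 * c\<^sup>2 * \<psi> l * cv p"
      by (metis abs_less_iff less_imp_le minus_le_iff)
    then show ?thesis using p(1) l by (simp add: box_def approximation_cone_def)
  qed
  then show thesis using C1(1) C2(1) c(1) half by (intro that[of "2 * C2 * c\<^sup>2" "1 / (2 * C1)"]) auto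
qed

lemma cone_in_sets:
  assumes "\<psi> \<in> borel_measurable (restrict_space borel {0<..})"
  shows "approximation_cone Q m v \<psi> \<in> sets vol"
proof -
  \<comment> \<open>Extending \<psi> by 0 makes it Borel on the whole line. The cone does not
    change, since 0 is not on the quadric.\<close>
  define \<phi> where "\<phi> t = indicator {0<..} t * \<psi> t" for t
  have [measurable]: "\<phi> \<in> borel_measurable borel"
    using assms by (subst (asm) borel_measurable_restrict_space_iff) (simp_all add: \<phi>_def[abs_def])
  have "0 \<notin> quadric Q m" using m_nonzero eq_half_polar[of 0] by (auto simp: quadric_def B_simps)
  then have "approximation_cone Q m v \<psi> =
      quadric Q m \<inter> {x \<in> space borel. norm (x /\<^sub>R norm x - v) < \<phi> (norm x)}"
    by (auto simp: approximation_cone_def radial_projection_def \<phi>_def indicator_def)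
  also have "\<dots> \<in> sets borel" by measurable
  finally show ?thesis by (auto simp: in_sets_vol approximation_cone_def)
qed

end

section \<open>Dyadic decomposition\<close>

lemma suminf_ennreal_eq_top_iff:
  assumes "\<And>k. 0 \<le> g k"
  shows "(\<Sum>k. ennreal (g k)) = \<infinity> \<longleftrightarrow> \<not> summable g"
proof
  show "\<not> summable g" if "(\<Sum>k. ennreal (g k)) = \<infinity>"
  proof
    assume "summable g"
    have "(\<Sum>k. ennreal (g k)) = ennreal (suminf g)"
      by (rule suminf_ennreal2) (fact assms \<open>summable g\<close>)+
    then show False using that by simp
  qed
  show "(\<Sum>k. ennreal (g k)) = \<infinity>" if "\<not> summable g"
  proof (rule ccontr)
    assume "(\<Sum>k. ennreal (g k)) \<noteq> \<infinity>"
    then have "summable g" by (intro summable_suminf_not_top assms) (simp only: infinity_ennreal_def not_False_eq_True)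
    then show False using that by simp
  qed
qed

lemma dyadic_floor:
  fixes x :: real
  assumes "x \<ge> 1"
  obtains k :: nat where "2 ^ k \<le> x" "x < 2 * 2 ^ k"
proof -
  obtain n :: nat where "x < 2 ^ n" using real_arch_pow[of 2 x] by auto
  then obtain k where "\<forall>i\<le>k. \<not> x < 2 ^ i" "x < 2 ^ Suc k"
    using ex_least_nat_less[of "\<lambda>k. x < 2 ^ k" n] assms by auto
  then show thesis using that[of k] by (auto simp: not_less)
qed

lemma disjoint_family_dyadic:
  assumes "\<And>k p. p \<in> A k \<Longrightarrow> 2 ^ k \<le> f p \<and> f p < 2 * (2 ^ k :: real)"
  shows "disjoint_family (A :: nat \<Rightarrow> 'b set)"
proof -
  have False if "i < j" "p \<in> A i" "p \<in> A j" for i j p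
  proof -
    have "(2::real) * 2 ^ i \<le> 2 ^ j" using that(1) power_increasing[of "Suc i" j "2::real"] by simp
    then show False using assms[OF that(2)] assms[OF that(3)] by linarith
  qed
  then show ?thesis unfolding disjoint_family_on_def by (metis disjoint_iff linorder_neqE_nat)
qed

lemma nn_integral_dyadic:
  fixes f :: "real \<Rightarrow> ennreal"
  assumes [measurable]: "f \<in> borel_measurable borel"
  shows "(\<integral>\<^sup>+t\<in>{1..}. f t \<partial>lborel) = (\<Sum>k. \<integral>\<^sup>+t\<in>{2 ^ k..<2 * 2 ^ k}. f t \<partial>lborel)"
proof -
  define A where "A k = {2 ^ k..<2 * 2 ^ k :: real}" for k :: nat
  \<comment> \<open>Viewing \<open>f\<close> as a density turns the splitting of the integral into
    countable additivity.\<close>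
  have "(\<Sum>k. emeasure (density lborel f) (A k)) = emeasure (density lborel f) (\<Union>k. A k)"
    by (intro suminf_emeasure disjoint_family_dyadic[of _ "\<lambda>x. x"]) (auto simp: A_def)
  moreover have "(\<Union>k. A k) = {1..}"
  proof -
    have "x \<in> (\<Union>k. A k)" if "x \<ge> 1" for x
      using dyadic_floor[OF that] by (auto simp: A_def)
    moreover have "x \<ge> 1" if "x \<in> A k" for x k
    proof -
      have "(1::real) \<le> 2 ^ k" by simp
      then show ?thesis using that unfolding A_def atLeastLessThan_iff by linarith
    qed
    ultimately show ?thesis by (intro set_eqI iffI) (auto simp only: atLeast_iff UN_iff)
  qed
  ultimately show ?thesis by (simp add: emeasure_density A_def)
qed

text \<open>The substitution is made on the compact intervals \<open>[0, n]\<close>, and continuity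
  from below of the two density measures gives the limit.\<close>

lemma nn_integral_exp_substitution:
  fixes f :: "real \<Rightarrow> ennreal"
  assumes [measurable]: "f \<in> borel_measurable borel"
  shows "(\<integral>\<^sup>+t\<in>{1..}. f t \<partial>lborel) = (\<integral>\<^sup>+t\<in>{0..}. f (exp t) * ennreal (exp t) \<partial>lborel)"
proof -
  define M where "M = density lborel f"
  define N where "N = density lborel (\<lambda>t. f (exp t) * ennreal (exp t))"
  have "(\<integral>\<^sup>+t. f t * indicator {exp 0..exp (real n)} t \<partial>lborel) =
      (\<integral>\<^sup>+t. f (exp t) * ennreal (exp t) * indicator {0..real n} t \<partial>lborel)" for n :: nat
  \<comment> \<open>The substitution rule asks for a nondegenerate interval; for
    \<open>n = 0\<close> both sides integrate over a single point.\<close>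
  proof (cases "n = 0")
    case True
    have "AE t in lborel. f t * indicator {exp 0..exp (real n)} t = 0"
      using AE_lborel_singleton[of "1::real"] by eventually_elim (simp add: True)
    moreover have "AE t in lborel. f (exp t) * ennreal (exp t) * indicator {0..real n} t = 0"
      using AE_lborel_singleton[of "0::real"] by eventually_elim (simp add: True)
    ultimately have "AE t in lborel. f t * indicator {exp 0..exp (real n)} t =
        f (exp t) * ennreal (exp t) * indicator {0..real n} t"
      by eventually_elim (simp only:)
    then show ?thesis by (rule nn_integral_cong_AE)
  next
    case False
    then show ?thesis
      by (intro nn_integral_substitution_aux) (auto intro!: derivative_eq_intros continuous_intros)
  qed
  then have "emeasure M {1..exp (real n)} = emeasure N {0..real n}" for n :: nat
    by (simp add: M_def N_def emeasure_density)
  moreover have "(SUP n. emeasure M {1..exp (real n)}) = emeasure M (\<Union>n. {1..exp (real n)})"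
    by (intro SUP_emeasure_incseq) (auto simp: incseq_def M_def)
  moreover have "(SUP n. emeasure N {0..real n}) = emeasure N (\<Union>n. {0..real n})"
    by (intro SUP_emeasure_incseq) (auto simp: incseq_def N_def)
  moreover have "(\<Union>n. {1..exp (real n)}) = {1..}" "(\<Union>n. {0..real n}) = {0..}"
  proof -
    have "\<exists>n. x \<le> exp (real n)" for x
      by (meson exp_ge_add_one_self less_imp_le order_trans reals_Archimedean2 le_add_same_cancel2 zero_le_one add_increasing)
    then show "(\<Union>n. {1..exp (real n)}) = {1..}" by auto
    show "(\<Union>n. {0..real n}) = {0..}" using real_arch_simple by auto
  qed
  ultimately show ?thesis by (simp add: M_def N_def emeasure_density)
qed

text \<open>On each dyadic interval the integrand is comparable to its value at
  \<open>2 ^ k\<close>; the length \<open>2 ^ k\<close> supplies the factor that raises the power of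
  \<open>t\<close> from \<open>n\<close> to \<open>Suc n\<close>.\<close>

lemma nn_integral_quasi_conformal_eq_top_iff:
  fixes \<psi> :: "real \<Rightarrow> real"
  assumes \<psi>: "\<forall>t>0. \<psi> t > 0" "quasi_conformal \<psi>"
    and meas: "(\<lambda>t. indicator {0<..} t * \<psi> t) \<in> borel_measurable borel"
  shows "(\<integral>\<^sup>+t\<in>{1..}. ennreal (t ^ n * \<psi> t ^ Suc n) \<partial>lborel) = \<infinity> \<longleftrightarrow>
    \<not> summable (\<lambda>k. (2 ^ k * \<psi> (2 ^ k)) ^ Suc n)"
proof -
  obtain c where c: "c \<ge> 1" "\<And>s t. 0 < t \<Longrightarrow> t / 2 \<le> s \<Longrightarrow> s \<le> 2 * t \<Longrightarrow> \<psi> s \<le> c * \<psi> t"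
    using quasi_conformalE[OF \<psi>(2,1)] by blast
  define \<phi> where "\<phi> t = indicator {0<..} t * \<psi> t" for t
  have [measurable]: "\<phi> \<in> borel_measurable borel" using meas by (simp add: \<phi>_def[abs_def])
  define a where "a k = (2 ^ k * \<psi> (2 ^ k)) ^ Suc n" for k :: nat
  define J where "J k = (\<integral>\<^sup>+t\<in>{2 ^ k..<2 * 2 ^ k}. ennreal (t ^ n * \<phi> t ^ Suc n) \<partial>lborel)" for k :: nat
  have pos: "\<psi> (2 ^ k) > 0" for k :: nat using \<psi> by simp
  have a0: "a k \<ge> 0" for k using pos[of k] by (simp add: a_def)
  have "(\<integral>\<^sup>+t\<in>{1..}. ennreal (t ^ n * \<psi> t ^ Suc n) \<partial>lborel) =
      (\<integral>\<^sup>+t\<in>{1..}. ennreal (t ^ n * \<phi> t ^ Suc n) \<partial>lborel)"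
    by (intro nn_integral_cong) (auto simp: \<phi>_def indicator_def)
  also have "\<dots> = (\<Sum>k. J k)" unfolding J_def by (rule nn_integral_dyadic) measurable
  finally have I: "(\<integral>\<^sup>+t\<in>{1..}. ennreal (t ^ n * \<psi> t ^ Suc n) \<partial>lborel) = (\<Sum>k. J k)" .
  have len: "(\<integral>\<^sup>+t. ennreal C * indicator {2 ^ k..<2 * 2 ^ k :: real} t \<partial>lborel) = ennreal (C * 2 ^ k)"
    if "C \<ge> 0" for C :: real and k :: nat
    using that by (simp add: nn_integral_cmult ennreal_mult)
  have up: "J k \<le> ennreal (2 ^ n * c ^ Suc n * a k)" for k
  proof -
    let ?C = "(2 * 2 ^ k) ^ n * (c * \<psi> (2 ^ k)) ^ Suc n"
    have "J k \<le> (\<integral>\<^sup>+t. ennreal ?C * indicator {2 ^ k..<2 * 2 ^ k :: real} t \<partial>lborel)"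
      unfolding J_def
    proof (intro nn_integral_mono)
      fix t :: real
      show "ennreal (t ^ n * \<phi> t ^ Suc n) * indicator {2 ^ k..<2 * 2 ^ k} t
          \<le> ennreal ?C * indicator {2 ^ k..<2 * 2 ^ k} t"
      proof (cases "t \<in> {2 ^ k..<2 * 2 ^ k}")
        case True
        then have "t > 0" using zero_less_power[of "2::real" k] by (auto intro: less_le_trans)
        moreover have "\<psi> t \<le> c * \<psi> (2 ^ k)" using True by (intro c(2)) auto
        moreover have "\<phi> t = \<psi> t" "\<psi> t > 0" using \<psi> \<open>t > 0\<close> by (auto simp: \<phi>_def)
        ultimately have "t ^ n * \<phi> t ^ Suc n \<le> ?C"
          using True c(1) pos[of k] by (intro mult_mono power_mono) auto
        then show ?thesis using True by (simp add: ennreal_leI)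
      qed auto
    qed
    also have "\<dots> = ennreal (?C * 2 ^ k)" using c(1) pos[of k] by (intro len) simp
    also have "?C * 2 ^ k = 2 ^ n * c ^ Suc n * a k" by (simp add: a_def power_mult_distrib mult_ac)
    finally show ?thesis .
  qed
  have low: "ennreal (1 / c ^ Suc n * a k) \<le> J k" for k
  proof -
    let ?C = "(2 ^ k) ^ n * (\<psi> (2 ^ k) / c) ^ Suc n"
    have "?C * 2 ^ k = 1 / c ^ Suc n * a k" by (simp add: a_def power_mult_distrib power_divide mult_ac)
    then have "ennreal (1 / c ^ Suc n * a k) = ennreal (?C * 2 ^ k)" by simp
    also have "\<dots> = (\<integral>\<^sup>+t. ennreal ?C * indicator {2 ^ k..<2 * 2 ^ k :: real} t \<partial>lborel)"
      using c(1) pos[of k] by (intro len[symmetric]) simp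
    also have "\<dots> \<le> J k" unfolding J_def
    proof (intro nn_integral_mono)
      fix t :: real
      show "ennreal ?C * indicator {2 ^ k..<2 * 2 ^ k} t
          \<le> ennreal (t ^ n * \<phi> t ^ Suc n) * indicator {2 ^ k..<2 * 2 ^ k} t"
      proof (cases "t \<in> {2 ^ k..<2 * 2 ^ k}")
        case True
        then have "t > 0" using zero_less_power[of "2::real" k] by (auto intro: less_le_trans)
        moreover from this have "\<psi> (2 ^ k) \<le> c * \<psi> t" using True by (intro c(2)) auto
        then have "\<psi> (2 ^ k) / c \<le> \<psi> t" using c(1) by (simp add: field_simps)
        moreover have "\<phi> t = \<psi> t" "\<psi> t > 0" using \<psi> \<open>t > 0\<close> by (auto simp: \<phi>_def)
        ultimately have "?C \<le> t ^ n * \<phi> t ^ Suc n"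
          using True c(1) pos[of k] by (intro mult_mono power_mono) auto
        then show ?thesis using True by (simp add: ennreal_leI)
      qed auto
    qed
    finally show ?thesis .
  qed
  have scale: "(\<Sum>k. ennreal (C * a k)) = \<infinity> \<longleftrightarrow> \<not> summable a" if "C > 0" for C
    using that a0 by (subst suminf_ennreal_eq_top_iff) (auto simp: summable_cmult_iff)
  have "(\<Sum>k. ennreal (1 / c ^ Suc n * a k)) \<le> (\<Sum>k. J k)"
    "(\<Sum>k. J k) \<le> (\<Sum>k. ennreal (2 ^ n * c ^ Suc n * a k))"
    using up low by (auto intro!: suminf_le)
  then have "(\<Sum>k. J k) = \<infinity> \<longleftrightarrow> \<not> summable a"
    using scale[of "1 / c ^ Suc n"] scale[of "2 ^ n * c ^ Suc n"] c(1)
    by (auto simp: top_unique simp del: power_Suc)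
  then show ?thesis by (simp only: I a_def[abs_def])
qed

section \<open>The volume of the cone as a dyadic series\<close>

context invariant_frame
begin

text \<open>A convergent series forces \<psi> to 0 at infinity, so outside a ball the cone is
  covered by boxes of finite total volume. A divergent one yields disjoint boxes inside the cone
  with infinite total volume.\<close>

lemma vol_cone_eq_top_iff:
  assumes v: "norm v = 1" and \<psi>: "\<forall>t>0. \<psi> t > 0" "quasi_conformal \<psi>"
    and meas: "\<psi> \<in> borel_measurable (restrict_space borel {0<..})" and E: "E \<noteq> {}"
  shows "emeasure vol (approximation_cone Q m v \<psi>) = \<infinity> \<longleftrightarrow>
    \<not> summable (\<lambda>k. (2 ^ k * \<psi> (2 ^ k)) ^ card E)"
proof
  define n where "n = card E"
  have n: "n > 0" using E finite_E by (simp add: n_def card_gt_0_iff)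
  define a where "a k = (2 ^ k * \<psi> (2 ^ k)) ^ n" for k :: nat
  let ?C = "approximation_cone Q m v \<psi>"
  define h where "h = measure vol (box 1 1)"
  have h: "h > 0" unfolding h_def by (rule vol_unit_box_pos)
  have pos: "\<psi> (2 ^ k) > 0" for k :: nat using \<psi> by simp
  have a0: "a k \<ge> 0" for k using pos[of k] by (simp add: a_def)
  obtain c where c: "c \<ge> 1" "\<And>s t. 0 < t \<Longrightarrow> t / 2 \<le> s \<Longrightarrow> s \<le> 2 * t \<Longrightarrow> \<psi> s \<le> c * \<psi> t"
    using quasi_conformalE[OF \<psi>(2,1)] by blast
  {
    assume inf: "emeasure vol ?C = \<infinity>"
    show "\<not> summable (\<lambda>k. (2 ^ k * \<psi> (2 ^ k)) ^ card E)"
    proof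
      assume "summable (\<lambda>k. (2 ^ k * \<psi> (2 ^ k)) ^ card E)"
      then have sum: "summable a" by (simp add: a_def[abs_def] n_def)
      obtain K \<delta> where K: "K > 0" "\<delta> > 0"
        "\<And>p l. p \<in> ?C \<Longrightarrow> \<psi> (norm p) \<le> \<delta> \<Longrightarrow> l > 0 \<Longrightarrow> l \<le> cv p \<Longrightarrow> cv p < 2 * l \<Longrightarrow> p \<in> box l (K * \<psi> l)"
        "\<And>p. p \<in> ?C \<Longrightarrow> \<psi> (norm p) \<le> \<delta> \<Longrightarrow> norm p / 2 \<le> cv p"
        using cone_subset_box[OF v \<psi>] by blast
      \<comment> \<open>The bound \<open>\<delta> / c\<close> at \<open>2 ^ k\<close> gives the
        bound \<delta> on the whole dyadic interval.\<close>
      have "\<forall>\<^sub>F k in sequentially. a k < (\<delta> / c) ^ n"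
        using summable_LIMSEQ_zero[OF sum] K(2) c(1) by (intro order_tendstoD) auto
      then obtain N where N: "\<And>k. k \<ge> N \<Longrightarrow> a k < (\<delta> / c) ^ n" by (auto simp: eventually_sequentially)
      have small: "\<psi> t \<le> \<delta>" if t: "t \<ge> 2 ^ Suc N" for t
      proof -
        have "(1::real) \<le> 2 ^ Suc N" by (rule one_le_power) simp
        then have "t \<ge> 1" using t by linarith
        then obtain k where k: "2 ^ k \<le> t" "t < 2 * 2 ^ k" by (rule dyadic_floor)
        have "N \<le> k"
        proof (rule ccontr)
          assume "\<not> ?thesis"
          then have "(2::real) ^ Suc k \<le> 2 ^ Suc N" by (intro power_increasing) auto
          then show False using k t unfolding power_Suc by linarith
        qed
        have "2 ^ k * \<psi> (2 ^ k) < \<delta> / c"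
          using N[OF \<open>N \<le> k\<close>] K(2) c(1) power_less_imp_less_base[of "2 ^ k * \<psi> (2 ^ k)" n "\<delta> / c"] by (simp add: a_def)
        moreover have "\<psi> (2 ^ k) \<le> 2 ^ k * \<psi> (2 ^ k)" using pos[of k] by simp
        ultimately have "\<psi> (2 ^ k) \<le> \<delta> / c" by linarith
        then have "c * \<psi> (2 ^ k) \<le> \<delta>" using c(1) by (simp add: field_simps)
        moreover have "\<psi> t \<le> c * \<psi> (2 ^ k)" using k by (intro c(2)) auto
        ultimately show ?thesis by linarith
      qed
      define U where "U = (\<Union>k. box (2 ^ k) (K * \<psi> (2 ^ k)))"
      \<comment> \<open>Outside this ball \<psi> is at most \<delta> and
        \<open>cv p \<ge> norm p / 2 \<ge> 1\<close>, so \<open>cv p\<close> lies in some dyadic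
        interval.\<close>
      let ?B = "quadric Q m \<inter> cball 0 (2 ^ Suc N)"
      have "?C \<subseteq> ?B \<union> U"
      proof
        fix p assume p: "p \<in> ?C"
        show "p \<in> ?B \<union> U"
        proof (cases "norm p \<le> 2 ^ Suc N")
          case True
          then show ?thesis using p by (auto simp: approximation_cone_def)
        next
          case False
          then have \<delta>: "\<psi> (norm p) \<le> \<delta>" by (intro small) simp
          have "(1::real) \<le> 2 ^ N" by simp
          then have "cv p \<ge> 1" using K(4)[OF p \<delta>] False unfolding power_Suc by linarith
          then obtain k where k: "2 ^ k \<le> cv p" "cv p < 2 * 2 ^ k" by (rule dyadic_floor)
          have "p \<in> box (2 ^ k) (K * \<psi> (2 ^ k))" using k by (intro K(3) p \<delta>) auto
          then show ?thesis by (auto simp: U_def)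
        qed
      qed
      moreover have U: "U \<in> sets vol" unfolding U_def by (intro sets.countable_UN) (auto simp: box_in_sets)
      moreover have B: "?B \<in> sets vol" by (auto simp: in_sets_vol closed_quadric borel_closed)
      ultimately have "emeasure vol ?C \<le> emeasure vol ?B + emeasure vol U"
        by (meson emeasure_mono emeasure_subadditive order_trans sets.Un)
      moreover have "emeasure vol U < \<infinity>"
      proof -
        have "emeasure vol U \<le> (\<Sum>k. emeasure vol (box (2 ^ k) (K * \<psi> (2 ^ k))))"
          unfolding U_def by (intro emeasure_subadditive_countably) (auto simp: box_in_sets)
        also have "\<dots> \<le> (\<Sum>k. ennreal ((2 * K) ^ n * h * a k))"
        proof (intro suminf_le)
          fix k :: nat
          have "emeasure vol (box (2 ^ k) (K * \<psi> (2 ^ k))) \<le> ennreal ((2 * (2 ^ k * (K * \<psi> (2 ^ k)))) ^ n * h)"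
            unfolding n_def h_def using K(1) pos[of k] by (intro vol_box_bounds(2)) auto
          also have "(2 * (2 ^ k * (K * \<psi> (2 ^ k)))) ^ n * h = (2 * K) ^ n * h * a k"
            by (simp add: a_def power_mult_distrib mult_ac)
          finally show "emeasure vol (box (2 ^ k) (K * \<psi> (2 ^ k))) \<le> ennreal ((2 * K) ^ n * h * a k)" .
        qed auto
        also have "\<dots> < \<infinity>"
        proof -
          have "(\<Sum>k. ennreal ((2 * K) ^ n * h * a k)) \<noteq> \<infinity>"
            using sum a0 h K(1) by (subst suminf_ennreal_eq_top_iff) (auto intro: summable_mult)
          then show ?thesis by (simp add: top.not_eq_extremum)
        qed
        finally show ?thesis .
      qed
      ultimately show False using inf vol_cball_finite[of "2 ^ Suc N"]
        by (metis ennreal_add_eq_top infinity_ennreal_def less_irrefl top.extremum_uniqueI)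
    qed
  }
  assume "\<not> summable (\<lambda>k. (2 ^ k * \<psi> (2 ^ k)) ^ card E)"
  then have not_sum: "\<not> summable a" by (simp add: a_def[abs_def] n_def)
  obtain \<epsilon> where \<epsilon>: "\<epsilon> > 0" "\<And>l r. l > 0 \<Longrightarrow> 0 \<le> r \<Longrightarrow> 1 / l\<^sup>2 + r \<le> \<epsilon> * min (\<psi> l) 1 \<Longrightarrow> box l r \<subseteq> ?C"
    using box_subset_cone[OF v \<psi>] by blast
  define \<phi> where "\<phi> k = min (\<psi> (2 ^ k)) 1" for k :: nat
  have \<phi>: "\<phi> k > 0" for k using pos[of k] by (simp add: \<phi>_def)
  define b where "b k = (2 ^ k * \<phi> k) ^ n" for k
  have b0: "b k \<ge> 0" for k using \<phi>[of k] by (simp add: b_def)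
  \<comment> \<open>If the truncated series converged, its terms would eventually be below 1; the
    truncation would then be inactive and the original series would converge too.\<close>
  have not_sum_b: "\<not> summable b"
  proof
    assume sum: "summable b"
    have "\<forall>\<^sub>F k in sequentially. b k < 1" using summable_LIMSEQ_zero[OF sum] by (intro order_tendstoD) auto
    then have "\<forall>\<^sub>F k in sequentially. b k = a k"
    proof eventually_elim
      case (elim k)
      have "2 ^ k * \<phi> k < 1"
        using elim power_less_imp_less_base[of "2 ^ k * \<phi> k" n 1] by (simp add: b_def)
      moreover have "\<phi> k \<le> 2 ^ k * \<phi> k" using \<phi>[of k] by simp
      ultimately have "\<phi> k < 1" by linarith
      then have "\<phi> k = \<psi> (2 ^ k)" by (auto simp: \<phi>_def min_def split: if_splits)
      then show ?case by (simp add: a_def b_def)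
    qed
    then show False using sum not_sum by (simp add: summable_cong)
  qed
  \<comment> \<open>The budget \<open>\<epsilon> * \<phi> k\<close> is split evenly: one half has to
    cover \<open>1 / l^2\<close> at \<open>l = 2 ^ k\<close>, the other becomes the radius of the
    box.\<close>
  define G where "G = {k. 1 / (2 ^ k)\<^sup>2 \<le> \<epsilon> / 2 * \<phi> k}"
  define g where "g k = (if k \<in> G then b k else 0)" for k
  have g0: "g k \<ge> 0" for k using b0 by (simp add: g_def)
  have not_sum_g: "\<not> summable g"
  proof
    assume sum: "summable g"
    \<comment> \<open>Off \<open>G\<close>, \<open>2 ^ k * \<phi> k\<close> is below
      \<open>2 / \<epsilon> * (1 / 2) ^ k\<close>, so the discarded terms are dominated by a
      geometric series; its ratio is below 1 because \<open>n > 0\<close>.\<close>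
    have "summable (\<lambda>k. ((1 / 2) ^ n) ^ k :: real)"
      using n by (intro summable_geometric) (simp add: power_less_one_iff)
    then have majorant: "summable (\<lambda>k. g k + (2 / \<epsilon>) ^ n * ((1 / 2) ^ n) ^ k)"
      by (intro summable_add sum summable_mult)
    have "norm (b k) \<le> g k + (2 / \<epsilon>) ^ n * ((1 / 2) ^ n) ^ k" for k
    proof (cases "k \<in> G")
      case False
      then have "\<epsilon> / 2 * \<phi> k \<le> 1 / (2 ^ k)\<^sup>2" by (simp add: G_def)
      then have "2 ^ k * \<phi> k \<le> 2 / \<epsilon> * (1 / 2) ^ k"
        using \<epsilon>(1) by (simp add: field_simps power2_eq_square)
      then have "b k \<le> (2 / \<epsilon> * (1 / 2) ^ k) ^ n" unfolding b_def using \<phi>[of k] by (intro power_mono) auto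
      also have "\<dots> = (2 / \<epsilon>) ^ n * ((1 / 2) ^ n) ^ k"
        by (simp only: power_mult_distrib power_mult[symmetric] mult.commute)
      finally show ?thesis using b0[of k] False by (simp add: g_def)
    qed (use b0[of k] \<epsilon>(1) in \<open>simp add: g_def\<close>)
    then have "summable b" using summable_comparison_test'[OF majorant, of 0 b] by simp
    then show False using not_sum_b by simp
  qed
  define D where "D k = (if k \<in> G then box (2 ^ k) (\<epsilon> / 2 * \<phi> k) else {})" for k
  have "D k \<subseteq> ?C" for k
  proof (cases "k \<in> G")
    case True
    have "box (2 ^ k) (\<epsilon> / 2 * \<phi> k) \<subseteq> ?C"
      using True \<epsilon>(1) \<phi>[of k] by (intro \<epsilon>(2)) (auto simp: G_def \<phi>_def)
    then show ?thesis by (simp add: D_def)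
  qed (simp add: D_def)
  then have "(\<Union>k. D k) \<subseteq> ?C" by blast
  then have D_C: "emeasure vol (\<Union>k. D k) \<le> emeasure vol ?C"
    by (rule emeasure_mono) (rule cone_in_sets[OF meas])
  have "disjoint_family D"
    by (rule disjoint_family_dyadic[of _ cv]) (auto simp: D_def box_def split: if_splits)
  moreover have "D k \<in> sets vol" for k by (simp add: D_def box_in_sets)
  ultimately have "(\<Sum>k. emeasure vol (D k)) = emeasure vol (\<Union>k. D k)"
    by (intro suminf_emeasure) auto
  note D_C[folded this]
  \<comment> \<open>The 4 combines the radius \<open>\<epsilon> / 2 * \<phi> k\<close> with the
    further halving in the lower volume bound.\<close>
  moreover have "(\<Sum>k. ennreal ((\<epsilon> / 4) ^ n * h * g k)) \<le> (\<Sum>k. emeasure vol (D k))"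
  proof (intro suminf_le)
    fix k :: nat
    show "ennreal ((\<epsilon> / 4) ^ n * h * g k) \<le> emeasure vol (D k)"
    proof (cases "k \<in> G")
      case True
      have "(\<epsilon> / 4) ^ n * h * g k = (2 ^ k * (\<epsilon> / 2 * \<phi> k) / 2) ^ n * h"
        using True by (simp add: g_def b_def power_mult_distrib power_divide mult_ac flip: power_mult_distrib)
      also have "ennreal \<dots> \<le> emeasure vol (D k)"
        using True \<epsilon>(1) \<phi>[of k] unfolding n_def h_def D_def by (simp only: if_True) (intro vol_box_bounds(1), auto)
      finally show ?thesis .
    qed (simp add: g_def)
  qed auto
  moreover have "(\<Sum>k. ennreal ((\<epsilon> / 4) ^ n * h * g k)) = \<infinity>"
    using not_sum_g g0 h \<epsilon>(1) by (subst suminf_ennreal_eq_top_iff) (auto simp: summable_cmult_iff)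
  ultimately show "emeasure vol ?C = \<infinity>" by (simp add: top_unique)
qed

end

theorem theorem2p1:
  fixes d :: nat
    and Q :: "real ^ 'n \<Rightarrow> real"
    and m :: real
    and vol :: "(real ^ 'n) measure"
    and \<psi> :: "real \<Rightarrow> real"
    and v :: "real ^ 'n"
  assumes "d \<ge> 3"
    and "CARD('n) = d + 1"
    and "rational_quadratic_form Q"
    and "nondegenerate_form Q"
    and "indefinite_form Q"
    and "m \<in> \<rat>"
    and "m \<noteq> 0"
    and "quadric Q m \<inter> integer_lattice \<noteq> {}"
    and "invariant_measure_on_quadric Q m vol"
    and "\<forall>t>0. \<psi> t > 0"
    and "\<psi> \<in> borel_measurable (restrict_space borel {0<..})"
    and "quasi_conformal \<psi>"
    and "v \<in> quadric_boundary Q"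
  shows "(emeasure vol (approximation_cone Q m v \<psi>) = \<infinity> \<longleftrightarrow>
           (\<integral>\<^sup>+t\<in>{1..}. ennreal (t ^ (d - 2) * \<psi> t ^ (d - 1)) \<partial>lborel) = \<infinity>) \<and>
         (\<integral>\<^sup>+t\<in>{1..}. ennreal (t ^ (d - 2) * \<psi> t ^ (d - 1)) \<partial>lborel) =
           (\<integral>\<^sup>+t\<in>{0..}. ennreal ((exp t * \<psi> (exp t)) ^ (d - 1)) \<partial>lborel)"
proof -
  have v: "Q v = 0" "norm v = 1" using assms(13) by (auto simp: quadric_boundary_def)
  then have "v \<noteq> 0" by auto
  obtain w E where frame: "isotropic_frame Q v w E" and "card E + 2 = DIM(real ^ 'n)"
    using ex_isotropic_frame[OF rational_quadratic_form_bilinear_polar[OF assms(3)]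
        rational_quadratic_form_eq_half_polar[OF assms(3)] assms(4) v(1) \<open>v \<noteq> 0\<close>] by blast
  with assms(1,2) have cardE: "card E = d - 1" and E: "E \<noteq> {}" by auto
  interpret invariant_frame Q v w E m vol
    using frame assms(4,7,9) by (simp add: invariant_frame_def invariant_frame_axioms_def)
  have d: "d - 1 = Suc (d - 2)" using assms(1) by simp
  have meas: "(\<lambda>t. indicator {0<..} t * \<psi> t) \<in> borel_measurable borel"
    using assms(11) by (subst (asm) borel_measurable_restrict_space_iff) simp_all
  have "emeasure vol (approximation_cone Q m v \<psi>) = \<infinity> \<longleftrightarrow>
      (\<integral>\<^sup>+t\<in>{1..}. ennreal (t ^ (d - 2) * \<psi> t ^ (d - 1)) \<partial>lborel) = \<infinity>"
    unfolding vol_cone_eq_top_iff[OF v(2) assms(10,12,11) E] cardE d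
      nn_integral_quasi_conformal_eq_top_iff[OF assms(10,12) meas] ..
  moreover have "(\<integral>\<^sup>+t\<in>{1..}. ennreal (t ^ (d - 2) * \<psi> t ^ (d - 1)) \<partial>lborel) =
      (\<integral>\<^sup>+t\<in>{0..}. ennreal ((exp t * \<psi> (exp t)) ^ (d - 1)) \<partial>lborel)"
  proof -
    \<comment> \<open>\<psi> is again cut off to be Borel on the line. The Jacobian
      \<open>exp t\<close> raises the power \<open>d - 2\<close> of \<open>exp t\<close> to
      \<open>d - 1\<close>.\<close>
    define f where "f t = ennreal (t ^ (d - 2) * (indicator {0<..} t * \<psi> t) ^ (d - 1))" for t
    have "f \<in> borel_measurable borel" using meas by (simp add: f_def[abs_def])
    then have "(\<integral>\<^sup>+t\<in>{1..}. f t \<partial>lborel) = (\<integral>\<^sup>+t\<in>{0..}. f (exp t) * ennreal (exp t) \<partial>lborel)"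
      by (rule nn_integral_exp_substitution)
    moreover have "f (exp t) * ennreal (exp t) = ennreal ((exp t * \<psi> (exp t)) ^ (d - 1))" for t
      using assms(10) unfolding f_def d
      by (simp add: power_mult_distrib mult_ac less_imp_le flip: ennreal_mult)
    moreover have "(\<integral>\<^sup>+t\<in>{1..}. f t \<partial>lborel) = (\<integral>\<^sup>+t\<in>{1..}. ennreal (t ^ (d - 2) * \<psi> t ^ (d - 1)) \<partial>lborel)"
      by (intro nn_integral_cong) (auto simp: f_def indicator_def)
    ultimately show ?thesis by simp
  qed
  ultimately show ?thesis by simp
qed

end
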